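(* Let $I\subseteq\mathbb R[x_1,\dots,x_n]$ be an ideal such that $\mathcal V_{\mathbb R}(I)$ is compact. Then $\bigcap_{k\ge0}\mathrm{TH}_k(I)=\operatorname{cl}(\operatorname{conv}(\mathcal V_{\mathbb R}(I)))$.
   Context: $\mathbb{R}[\mathbf x]_k$ denotes the polynomials of degree at most $k$. $\mathcal V_{\mathbb R}(I)=\{x\in\mathbb R^n: f(x)=0\ \forall f\in I\}$. A polynomial $h$ is $k$-sos modulo $I$ if there are $g_1,\dots,g_r\in\mathbb{R}[\mathbf x]_k$ with $h-\sum_i g_i^2\in I$. The $k$-th theta body is $\mathrm{TH}_k(I)=\{p\in\mathbb R^n: l(p)\ge 0$ for every $l\in\mathbb{R}[\mathbf x]_1$ that is $k$-sos modulo $I\}$. *)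

theory Defs
  imports "HOL-Analysis.Analysis" "HOL-Library.Poly_Mapping"
begin

(* Real polynomials in the variables indexed by the finite type 'n
  (so n = CARD('n)): a finitely supported map from monomials (exponent
  vectors 'n \<Rightarrow>\<^sub>0 nat) to real coefficients. This is a comm_ring_1.*)
type_synonym 'n rpoly = "('n \<Rightarrow>\<^sub>0 nat) \<Rightarrow>\<^sub>0 real"

definition mon_deg :: "('n::finite \<Rightarrow>\<^sub>0 nat) \<Rightarrow> nat" where
  "mon_deg m = (\<Sum>i\<in>UNIV. Poly_Mapping.lookup m i)"

(* Total degree; a polynomial lies in R[x]_k iff total_deg p \<le> k (the zero
  polynomial has degree 0 here, which belongs to every R[x]_k).*)
definition total_deg :: "'n::finite rpoly \<Rightarrow> nat" where
  "total_deg p = (if Poly_Mapping.keys p = {} then 0 else Max (mon_deg ` Poly_Mapping.keys p))"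

definition eval :: "'n::finite rpoly \<Rightarrow> real ^ 'n \<Rightarrow> real" where
  "eval p x = (\<Sum>m\<in>Poly_Mapping.keys p. Poly_Mapping.lookup p m * (\<Prod>i\<in>UNIV. (x $ i) ^ Poly_Mapping.lookup m i))"

definition is_ideal :: "'n::finite rpoly set \<Rightarrow> bool" where
  "is_ideal I \<longleftrightarrow> 0 \<in> I \<and> (\<forall>a\<in>I. \<forall>b\<in>I. a + b \<in> I) \<and> (\<forall>a\<in>I. \<forall>r. r * a \<in> I)"

definition real_variety :: "'n::finite rpoly set \<Rightarrow> (real ^ 'n) set" where
  "real_variety I = {x. \<forall>f\<in>I. eval f x = 0}"

definition k_sos_mod :: "nat \<Rightarrow> 'n::finite rpoly set \<Rightarrow> 'n rpoly \<Rightarrow> bool" where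
  "k_sos_mod k I h \<longleftrightarrow>
     (\<exists>gs. (\<forall>g\<in>set gs. total_deg g \<le> k) \<and> h - (\<Sum>g\<leftarrow>gs. g ^ 2) \<in> I)"

definition theta_body :: "nat \<Rightarrow> 'n::finite rpoly set \<Rightarrow> (real ^ 'n) set" where
  "theta_body k I = {p. \<forall>l. total_deg l \<le> 1 \<longrightarrow> k_sos_mod k I l \<longrightarrow> eval l p \<ge> 0}"

end

theory Submission
  imports Defs "HOL-Algebra.Algebraic_Closure_Type"
begin

text \<open>
  The convergence of the theta bodies reduces, by separating a point from the closed convex hull,
  to a theorem of Schmuedgen: a polynomial that is positive on a compact real variety \<open>V(I)\<close> is a
  sum of squares modulo \<open>I\<close>. That follows from the Positivstellensatz \<open>s l = 1 + t\<close> modulo \<open>I\<close>, once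
  for \<open>R - \<Sum>x\<^sub>i\<^sup>2\<close>, which makes the sums of squares modulo \<open>I\<close> archimedean, and once for \<open>l\<close> itself.
  If the Positivstellensatz fails, the preordering generated by \<open>I\<close> and \<open>- l\<close> extends to a prime
  cone, that is, to a ring homomorphism into an ordered field and hence into its real closure.
  By the Artin--Lang theorem finitely many sign conditions satisfied there also hold at a real
  point, and by Hilbert's basis theorem finitely many suffice to cut out \<open>V(I)\<close>. The Artin--Lang
  theorem is obtained by lifting one variable at a time; the step is the sign table method of
  Cohen and Hoermander, which compares finite families of univariate polynomials that are closed
  under derivatives and remainders.
\<close>

hide_const (open) Polynomials.degree Polynomials.lead_coeff UnivPoly.eval up_ring.coeff up_ring.monom
  Module.module.smult Coset.order
section \<open>Polynomials over real closed fields\<close>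

class rcf = linordered_field +
  assumes sum_IVT_rcf:
    "a < b \<Longrightarrow> (\<Sum>k\<le>n. c k * a ^ k) < 0 \<Longrightarrow> 0 < (\<Sum>k\<le>n. c k * b ^ k) \<Longrightarrow>
      \<exists>x. a < x \<and> x < b \<and> (\<Sum>k\<le>n. c k * x ^ k) = 0"

lemma poly_IVT_rcf:
  fixes p :: "'a::rcf poly"
  shows "a < b \<Longrightarrow> poly p a < 0 \<Longrightarrow> 0 < poly p b \<Longrightarrow> \<exists>x. a < x \<and> x < b \<and> poly p x = 0"
  unfolding poly_altdef by (rule sum_IVT_rcf)

lemma sum_eq_poly_sum_monom: "(\<Sum>k\<le>n. c k * x ^ k) = poly (\<Sum>k\<le>n. monom (c k) k) x"
  for x :: "'a::comm_ring_1"
  by (simp add: poly_sum poly_monom)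

instance real :: rcf
  by standard (unfold sum_eq_poly_sum_monom, rule poly_IVT_pos)

lemma poly_IVT_sgn:
  fixes p :: "'a::rcf poly"
  assumes "a < b" "sgn (poly p a) \<noteq> sgn (poly p b)" "poly p a \<noteq> 0" "poly p b \<noteq> 0"
  shows "\<exists>x. a < x \<and> x < b \<and> poly p x = 0"
proof (cases "poly p a < 0")
  case True
  then have "0 < poly p b" using assms by (auto simp: sgn_if split: if_splits)
  then show ?thesis using poly_IVT_rcf[OF assms(1) True] by blast
next
  case False
  then have "poly (- p) a < 0" "0 < poly (- p) b" using assms by (auto simp: sgn_if split: if_splits)
  then show ?thesis using poly_IVT_rcf[OF assms(1), of "- p"] by auto
qed

lemma sgn_poly_eq_if_no_root:
  fixes p :: "'a::rcf poly"
  assumes "a \<le> b" "poly p a \<noteq> 0" "poly p b \<noteq> 0" "\<And>x. a < x \<Longrightarrow> x < b \<Longrightarrow> poly p x \<noteq> 0"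
  shows "sgn (poly p a) = sgn (poly p b)"
  using poly_IVT_sgn[of a b p] assms by (cases "a = b") auto

lemma poly_Rolle_consecutive:
  fixes p :: "'a::rcf poly"
  assumes ab: "a < b" and roots: "poly p a = 0" "poly p b = 0"
    and nr: "\<And>x. a < x \<Longrightarrow> x < b \<Longrightarrow> poly p x \<noteq> 0"
  shows "\<exists>x. a < x \<and> x < b \<and> poly (pderiv p) x = 0"
proof -
  have "p \<noteq> 0" using nr[of "(a + b) / 2"] ab by (auto simp: field_simps)
  obtain r where r: "p = [:-a, 1:] ^ order a p * r" "\<not> [:-a, 1:] dvd r"
    using order_decomp[OF \<open>p \<noteq> 0\<close>] by blast
  have "r \<noteq> 0" using r(2) by auto
  obtain q where q: "r = [:-b, 1:] ^ order b r * q" "\<not> [:-b, 1:] dvd q"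
    using order_decomp[OF \<open>r \<noteq> 0\<close>] by blast
  have ra: "poly r a \<noteq> 0" using r(2) by (simp add: poly_eq_0_iff_dvd)
  have "order a p \<noteq> 0" using roots(1) \<open>p \<noteq> 0\<close> by (simp add: order_root)
  then obtain m where m: "order a p = Suc m" by (cases "order a p") auto
  have "poly r b = 0" using roots(2) arg_cong[OF r(1), of "\<lambda>p. poly p b"] ab by simp
  then have "order b r \<noteq> 0" using \<open>r \<noteq> 0\<close> by (simp add: order_root)
  then obtain n where n: "order b r = Suc n" by (cases "order b r") auto
  have p: "p = [:-a, 1:] ^ Suc m * ([:-b, 1:] ^ Suc n * q)" using r(1) q(1) m n by metis
  have qb: "poly q b \<noteq> 0" using q(2) by (simp add: poly_eq_0_iff_dvd)
  have qa: "poly q a \<noteq> 0" using ra arg_cong[OF q(1), of "\<lambda>p. poly p a"] by auto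
  have qnr: "poly q x \<noteq> 0" if "a < x" "x < b" for x
    using nr[OF that] arg_cong[OF p, of "\<lambda>p. poly p x"] by auto
  have sq: "sgn (poly q a) = sgn (poly q b)"
    using sgn_poly_eq_if_no_root[OF _ qa qb qnr] ab by auto
  define A B where "A = [:-a, 1:]" and "B = [:-b, 1:]"
  define h where "h = smult (of_nat (Suc m)) (B * q) + smult (of_nat (Suc n)) (A * q)
    + A * B * pderiv q"
  have AB': "pderiv A = 1" "pderiv B = 1" by (simp_all add: A_def B_def pderiv_pCons)
  have dp: "pderiv p = A ^ m * B ^ n * h"
    unfolding p h_def A_def[symmetric] B_def[symmetric] pderiv_mult pderiv_power_Suc AB'
    by (simp add: algebra_simps del: of_nat_Suc)
  have ha: "poly h a = - (of_nat (Suc m) * (b - a)) * poly q a"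
    by (simp add: h_def A_def B_def algebra_simps)
  have hb: "poly h b = (of_nat (Suc n) * (b - a)) * poly q b"
    by (simp add: h_def A_def B_def algebra_simps)
  have pos: "of_nat (Suc m) * (b - a) > 0" "of_nat (Suc n) * (b - a) > 0"
    using ab by (auto intro!: mult_pos_pos simp del: of_nat_Suc)
  have "sgn (u * y) = sgn y" "sgn (- u * y) = - sgn y" if "u > 0" for u y :: 'a
    using that by (simp_all add: sgn_mult)
  then have "sgn (poly h a) = - sgn (poly q a)" "sgn (poly h b) = sgn (poly q b)"
    unfolding ha hb using pos by blast+
  then have "sgn (poly h a) \<noteq> sgn (poly h b)" "poly h a \<noteq> 0" "poly h b \<noteq> 0"
    using sq qa qb by (auto simp: sgn_if split: if_splits)
  from poly_IVT_sgn[OF ab this] have "\<exists>x. a < x \<and> x < b \<and> poly h x = 0" .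
  then show ?thesis unfolding dp by auto
qed

lemma poly_Rolle_rcf:
  fixes p :: "'a::rcf poly"
  assumes ab: "a < b" and roots: "poly p a = 0" "poly p b = 0"
  shows "\<exists>x. a < x \<and> x < b \<and> poly (pderiv p) x = 0"
proof (cases "p = 0")
  case True
  then show ?thesis using dense[OF ab] by auto
next
  case False
  define S where "S = {x. poly p x = 0 \<and> a < x}"
  have fin: "finite S" unfolding S_def using poly_roots_finite[OF False] by auto
  have "b \<in> S" using assms by (auto simp: S_def)
  define c where "c = Min S"
  have c: "c \<in> S" "c \<le> b" unfolding c_def using fin \<open>b \<in> S\<close> Min_in by (auto intro: Min_in)
  have "poly p x \<noteq> 0" if "a < x" "x < c" for x
  proof
    assume "poly p x = 0"
    then have "c \<le> x" using that fin unfolding c_def by (intro Min_le) (auto simp: S_def)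
    then show False using that by simp
  qed
  then obtain x where "a < x" "x < c" "poly (pderiv p) x = 0"
    using poly_Rolle_consecutive[of a c p] c roots by (auto simp: S_def)
  then show ?thesis using c(2) by force
qed

lemma poly_MVT_rcf:
  fixes p :: "'a::rcf poly"
  assumes ab: "a < b"
  shows "\<exists>x. a < x \<and> x < b \<and> poly p b - poly p a = (b - a) * poly (pderiv p) x"
proof -
  define m where "m = (poly p b - poly p a) / (b - a)"
  have m: "m * (b - a) = poly p b - poly p a" using ab by (simp add: m_def)
  define q where "q = p - [:poly p a - m * a, m:]"
  have "poly q a = 0" "poly q b = 0" using m by (simp_all add: q_def algebra_simps)
  from poly_Rolle_rcf[OF ab this] obtain x where x: "a < x" "x < b" "poly (pderiv q) x = 0" by blast
  then have "poly (pderiv p) x = m" by (simp add: q_def pderiv_diff pderiv_pCons)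
  then show ?thesis using x m by (auto simp: mult.commute)
qed

section \<open>Transfer of sign conditions in one variable\<close>

definition same_sign :: "'a::linordered_idom \<Rightarrow> 'b::linordered_idom \<Rightarrow> bool" where
  "same_sign x y \<longleftrightarrow> (0 < x \<longleftrightarrow> 0 < y) \<and> (x < 0 \<longleftrightarrow> y < 0)"

lemma same_sign_zero_iff: "same_sign x y \<Longrightarrow> x = 0 \<longleftrightarrow> y = 0"
  unfolding same_sign_def by (metis less_irrefl linorder_neqE)

lemma same_sign_zero [simp]: "same_sign 0 0"
  by (simp add: same_sign_def)

lemma same_sign_sgn_cong:
  "sgn x = sgn x' \<Longrightarrow> sgn y = sgn y' \<Longrightarrow> same_sign x y \<longleftrightarrow> same_sign x' y'"
  unfolding same_sign_def by (metis sgn_greater sgn_less)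

lemma same_sign_mult:
  "same_sign a c \<Longrightarrow> same_sign b d \<Longrightarrow> same_sign (a * b) (c * d)"
  by (auto simp: same_sign_def zero_less_mult_iff mult_less_0_iff)

lemma same_sign_mult_pos: "0 < a \<Longrightarrow> 0 < c \<Longrightarrow> same_sign (a * b) (c * d) \<longleftrightarrow> same_sign b d"
  by (auto simp: same_sign_def zero_less_mult_iff mult_less_0_iff)

lemma gap_same_sign:
  fixes p :: "'a::rcf poly" and q :: "'b::rcf poly"
  assumes t: "z < t" "t < z'" and s: "w < s" "s < w'"
    and deg: "degree p = degree q" and lc: "same_sign (lead_coeff p) (lead_coeff q)"
    and ends: "same_sign (poly p z) (poly q w)" "same_sign (poly p z') (poly q w')"
    and nrp: "\<And>x. p \<noteq> 0 \<Longrightarrow> z < x \<Longrightarrow> x < z' \<Longrightarrow> poly p x \<noteq> 0"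
    and nrq: "\<And>x. q \<noteq> 0 \<Longrightarrow> w < x \<Longrightarrow> x < w' \<Longrightarrow> poly q x \<noteq> 0"
    and nrd: "\<And>x. degree p > 0 \<Longrightarrow> z < x \<Longrightarrow> x < z' \<Longrightarrow> poly (pderiv p) x \<noteq> 0"
  shows "same_sign (poly p t) (poly q s)"
proof -
  have z: "p = 0 \<longleftrightarrow> q = 0" using same_sign_zero_iff[OF lc] by simp
  consider "p = 0" | "p \<noteq> 0" "degree p = 0" | "p \<noteq> 0" "degree p > 0" by auto
  then show ?thesis
  proof cases
    case 1
    then show ?thesis using z by simp
  next
    case 2
    then obtain a b where "p = [:a:]" "q = [:b:]" using deg by (metis degree_eq_zeroE)
    then show ?thesis using lc by (simp split: if_splits)
  next
    case 3
    have "q \<noteq> 0" using 3 z by simp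
    have pt: "poly p t \<noteq> 0" and qs: "poly q s \<noteq> 0" using nrp nrq t s 3 \<open>q \<noteq> 0\<close> by auto
    have "poly p z \<noteq> 0 \<or> poly p z' \<noteq> 0"
      using poly_Rolle_rcf[of z z' p] t nrd[OF 3(2)] by force
    then show ?thesis
    proof
      assume pz: "poly p z \<noteq> 0"
      then have qw: "poly q w \<noteq> 0" using same_sign_zero_iff[OF ends(1)] by simp
      have "sgn (poly p z) = sgn (poly p t)"
        by (rule sgn_poly_eq_if_no_root) (use t pz pt nrp 3 in auto)
      moreover have "sgn (poly q w) = sgn (poly q s)"
        by (rule sgn_poly_eq_if_no_root) (use s qw qs nrq \<open>q \<noteq> 0\<close> in auto)
      ultimately show ?thesis using ends(1) same_sign_sgn_cong by metis
    next
      assume pz: "poly p z' \<noteq> 0"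
      then have qw: "poly q w' \<noteq> 0" using same_sign_zero_iff[OF ends(2)] by simp
      have "sgn (poly p t) = sgn (poly p z')"
        by (rule sgn_poly_eq_if_no_root) (use t pz pt nrp 3 in auto)
      moreover have "sgn (poly q s) = sgn (poly q w')"
        by (rule sgn_poly_eq_if_no_root) (use s qw qs nrq \<open>q \<noteq> 0\<close> in auto)
      ultimately show ?thesis using ends(2) same_sign_sgn_cong by metis
    qed
  qed
qed

lemma monotone_gap_root_iff:
  fixes p :: "'a::rcf poly"
  assumes lt: "z < z'" and nrd: "\<And>x. z < x \<Longrightarrow> x < z' \<Longrightarrow> poly (pderiv p) x \<noteq> 0"
  shows "(\<exists>x. z < x \<and> x < z' \<and> poly p x = 0) \<longleftrightarrow> poly p z * poly p z' < 0"
proof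
  assume "\<exists>x. z < x \<and> x < z' \<and> poly p x = 0"
  then obtain x where x: "z < x" "x < z'" "poly p x = 0" by blast
  obtain u where u: "z < u" "u < x" "poly p x - poly p z = (x - z) * poly (pderiv p) u"
    using poly_MVT_rcf[OF x(1)] by blast
  obtain v where v: "x < v" "v < z'" "poly p z' - poly p x = (z' - x) * poly (pderiv p) v"
    using poly_MVT_rcf[OF x(2)] by blast
  have nz: "poly (pderiv p) u \<noteq> 0" "poly (pderiv p) v \<noteq> 0" using nrd u v x by auto
  have "sgn (poly (pderiv p) u) = sgn (poly (pderiv p) v)"
    by (rule sgn_poly_eq_if_no_root) (use u v x nrd in auto)
  then have "0 < poly (pderiv p) u * poly (pderiv p) v" using nz
    by (metis linorder_neqE_linordered_idom mult_neg_neg mult_pos_pos sgn_greater sgn_less)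
  moreover have "poly p z = - ((x - z) * poly (pderiv p) u)" "poly p z' = (z' - x) * poly (pderiv p) v"
    using u(3) v(3) x(3) by (simp_all add: minus_equation_iff[of "poly p z"])
  then have "poly p z * poly p z' = - ((x - z) * (z' - x) * (poly (pderiv p) u * poly (pderiv p) v))"
    by (simp only: mult_minus_left mult_minus_right mult_ac)
  ultimately show "poly p z * poly p z' < 0" using x by simp
next
  assume "poly p z * poly p z' < 0"
  then show "\<exists>x. z < x \<and> x < z' \<and> poly p x = 0"
    using poly_IVT_sgn[OF lt, of p] by (auto simp: mult_less_0_iff sgn_if)
qed

locale matched_family =
  fixes A :: "'i set" and P :: "'i \<Rightarrow> 'a::rcf poly" and Q :: "'i \<Rightarrow> 'b::rcf poly"
  assumes finite: "finite A"
    and degree_eq: "i \<in> A \<Longrightarrow> degree (P i) = degree (Q i)"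
    and lead_same_sign: "i \<in> A \<Longrightarrow> same_sign (lead_coeff (P i)) (lead_coeff (Q i))"
    and pderiv_closed: "i \<in> A \<Longrightarrow> degree (P i) > 0 \<Longrightarrow>
      \<exists>k\<in>A. P k = pderiv (P i) \<and> Q k = pderiv (Q i)"
    and rem_closed: "i \<in> A \<Longrightarrow> j \<in> A \<Longrightarrow> 0 < degree (P j) \<Longrightarrow> degree (P j) \<le> degree (P i) \<Longrightarrow>
      \<exists>k\<in>A. \<exists>c d u v. 0 < c \<and> 0 < d \<and> smult c (P i) = P j * u + P k \<and>
        smult d (Q i) = Q j * v + Q k \<and> degree (P k) < degree (P j)"
begin

definition matched :: "'a \<times> 'b \<Rightarrow> bool" where
  "matched x \<longleftrightarrow> (\<forall>i\<in>A. same_sign (poly (P i) (fst x)) (poly (Q i) (snd x)))"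

definition gap :: "'i set \<Rightarrow> 'a \<times> 'b \<Rightarrow> 'a \<times> 'b \<Rightarrow> bool" where
  "gap J x y \<longleftrightarrow> fst x < fst y \<and> snd x < snd y \<and> (\<forall>i\<in>J. P i \<noteq> 0 \<longrightarrow>
     (\<forall>t. fst x < t \<and> t < fst y \<longrightarrow> poly (P i) t \<noteq> 0) \<and>
     (\<forall>s. snd x < s \<and> s < snd y \<longrightarrow> poly (Q i) s \<noteq> 0))"

definition degree_closed :: "'i set \<Rightarrow> bool" where
  "degree_closed J \<longleftrightarrow> J \<subseteq> A \<and> (\<forall>j\<in>J. \<forall>i\<in>A. degree (P i) < degree (P j) \<longrightarrow> i \<in> J)"

lemma P_eq_0_iff: "i \<in> A \<Longrightarrow> P i = 0 \<longleftrightarrow> Q i = 0"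
  using same_sign_zero_iff[OF lead_same_sign] by simp

lemma gap_pderiv:
  assumes J: "\<forall>k\<in>A. degree (P k) < degree (P i) \<longrightarrow> k \<in> J" and g: "gap J x y"
    and i: "i \<in> A" "degree (P i) > 0"
  shows "\<And>t. fst x < t \<Longrightarrow> t < fst y \<Longrightarrow> poly (pderiv (P i)) t \<noteq> 0"
    "\<And>t. snd x < t \<Longrightarrow> t < snd y \<Longrightarrow> poly (pderiv (Q i)) t \<noteq> 0"
proof -
  obtain k where k: "k \<in> A" "P k = pderiv (P i)" "Q k = pderiv (Q i)"
    using pderiv_closed[OF i] by blast
  have "degree (P k) < degree (P i)" using i k by (simp add: degree_pderiv)
  then have "k \<in> J" using J k by blast
  moreover have "P k \<noteq> 0" using k(2) i by (simp add: pderiv_eq_0_iff)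
  ultimately show "\<And>t. fst x < t \<Longrightarrow> t < fst y \<Longrightarrow> poly (pderiv (P i)) t \<noteq> 0"
    "\<And>t. snd x < t \<Longrightarrow> t < snd y \<Longrightarrow> poly (pderiv (Q i)) t \<noteq> 0"
    using g k unfolding gap_def by auto
qed

lemma gap_same_sign_member:
  assumes J: "degree_closed J" and g: "gap J x y" and m: "matched x" "matched y" and i: "i \<in> J"
    and t: "fst x < t" "t < fst y" and s: "snd x < s" "s < snd y"
  shows "same_sign (poly (P i) t) (poly (Q i) s)"
proof -
  have iA: "i \<in> A" and J': "\<forall>k\<in>A. degree (P k) < degree (P i) \<longrightarrow> k \<in> J"
    using J i unfolding degree_closed_def by auto
  show ?thesis
    using gap_same_sign[OF t s degree_eq[OF iA] lead_same_sign[OF iA]] m g i iA P_eq_0_iff[OF iA]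
      gap_pderiv(1)[OF J' g iA]
    unfolding matched_def gap_def by blast
qed

lemma gap_split:
  assumes J: "degree_closed J" and n: "n \<in> A" "\<forall>k\<in>A. degree (P k) < degree (P n) \<longrightarrow> k \<in> J"
    and g: "gap J x y" and m: "matched x" "matched y" and ng: "\<not> gap (insert n J) x y"
  shows "\<exists>z. gap (insert n J) x z \<and> gap (insert n J) z y \<and> matched z"
proof -
  have "P n \<noteq> 0" and ex: "(\<exists>t. fst x < t \<and> t < fst y \<and> poly (P n) t = 0) \<or>
      (\<exists>s. snd x < s \<and> s < snd y \<and> poly (Q n) s = 0)"
    using g ng unfolding gap_def by auto
  then have "Q n \<noteq> 0" using P_eq_0_iff[OF n(1)] by simp
  have deg: "degree (P n) > 0"
  proof (rule ccontr)
    assume "\<not> 0 < degree (P n)"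
    then obtain a b where "P n = [:a:]" "Q n = [:b:]"
      using degree_eq[OF n(1)] by (metis degree_eq_zeroE neq0_conv)
    then show False using \<open>P n \<noteq> 0\<close> \<open>Q n \<noteq> 0\<close> ex by auto
  qed
  have lt: "fst x < fst y" "snd x < snd y" using g unfolding gap_def by auto
  note nrd = gap_pderiv[OF n(2) g n(1) deg]
  have "same_sign (poly (P n) (fst x) * poly (P n) (fst y)) (poly (Q n) (snd x) * poly (Q n) (snd y))"
    using m n(1) unfolding matched_def by (intro same_sign_mult) auto
  then obtain r s where r: "fst x < r" "r < fst y" "poly (P n) r = 0"
      and s: "snd x < s" "s < snd y" "poly (Q n) s = 0"
    using ex monotone_gap_root_iff[OF lt(1), of "P n"] monotone_gap_root_iff[OF lt(2), of "Q n"] nrd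
    unfolding same_sign_def by blast
  have ur: "poly (P n) t \<noteq> 0" if "fst x < t" "t < fst y" "t < r \<or> r < t" for t
    using that(3)
  proof
    assume "t < r"
    then show ?thesis using poly_Rolle_rcf[of t r "P n"] nrd(1) that(1) r by (meson order.strict_trans)
  next
    assume "r < t"
    then show ?thesis using poly_Rolle_rcf[of r t "P n"] nrd(1) that(2) r by (meson order.strict_trans)
  qed
  have us: "poly (Q n) t \<noteq> 0" if "snd x < t" "t < snd y" "t < s \<or> s < t" for t
    using that(3)
  proof
    assume "t < s"
    then show ?thesis using poly_Rolle_rcf[of t s "Q n"] nrd(2) that(1) s by (meson order.strict_trans)
  next
    assume "s < t"
    then show ?thesis using poly_Rolle_rcf[of s t "Q n"] nrd(2) that(2) s by (meson order.strict_trans)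
  qed
  have "gap (insert n J) x (r, s)" "gap (insert n J) (r, s) y"
    unfolding gap_def fst_conv snd_conv ball_simps(7)
    using ur us r(1,2) s(1,2) g[unfolded gap_def] by (meson order.strict_trans)+
  moreover have "matched (r, s)"
    unfolding matched_def
  proof
    fix i assume i: "i \<in> A"
    show "same_sign (poly (P i) (fst (r, s))) (poly (Q i) (snd (r, s)))"
    proof (cases "i \<in> J")
      case True
      then show ?thesis using gap_same_sign_member[OF J g m] r s by simp
    next
      case False
      then have "degree (P n) \<le> degree (P i)" using n(2) i by (meson not_less)
      from rem_closed[OF i n(1) deg this] obtain k c d u v where k: "k \<in> A" "0 < c" "0 < d"
        "smult c (P i) = P n * u + P k" "smult d (Q i) = Q n * v + Q k" "degree (P k) < degree (P n)"
        by blast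
      have "same_sign (poly (P k) r) (poly (Q k) s)"
        using gap_same_sign_member[OF J g m _ r(1,2) s(1,2)] k n(2) by blast
      moreover have "c * poly (P i) r = poly (P k) r" "d * poly (Q i) s = poly (Q k) s"
        using arg_cong[OF k(4), of "\<lambda>p. poly p r"] arg_cong[OF k(5), of "\<lambda>p. poly p s"] r s by auto
      ultimately show ?thesis using same_sign_mult_pos[OF k(2,3)] by (metis fst_conv snd_conv)
    qed
  qed
  ultimately show ?thesis by blast
qed

lemma refine_chain:
  assumes J: "degree_closed J" and n: "n \<in> A" "\<forall>k\<in>A. degree (P k) < degree (P n) \<longrightarrow> k \<in> J"
  shows "xs \<noteq> [] \<Longrightarrow> successively (gap J) xs \<Longrightarrow> \<forall>x\<in>set xs. matched x \<Longrightarrow>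
    \<exists>ys. ys \<noteq> [] \<and> hd ys = hd xs \<and> last ys = last xs \<and> successively (gap (insert n J)) ys \<and>
      (\<forall>y\<in>set ys. matched y)"
proof (induction xs rule: induct_list012)
  case (2 x)
  then show ?case by (intro exI[of _ "[x]"]) auto
next
  case (3 x y zs)
  obtain ys where ys: "ys \<noteq> []" "hd ys = y" "last ys = last (y # zs)"
    "successively (gap (insert n J)) ys" "\<forall>y\<in>set ys. matched y"
    using 3 by auto
  have xy: "gap J x y" "matched x" "matched y" using 3 by auto
  show ?case
  proof (cases "gap (insert n J) x y")
    case True
    then show ?thesis using ys xy by (intro exI[of _ "x # ys"]) (auto simp: successively_Cons)
  next
    case False
    from gap_split[OF J n xy this] obtain z
      where "gap (insert n J) x z" "gap (insert n J) z y" "matched z" by blast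
    then show ?thesis using ys xy by (intro exI[of _ "x # z # ys"]) (auto simp: successively_Cons)
  qed
qed auto

lemma full_chain:
  assumes "matched x" "matched y" "fst x < fst y" "snd x < snd y" "degree_closed J"
  shows "\<exists>ys. ys \<noteq> [] \<and> hd ys = x \<and> last ys = y \<and> successively (gap J) ys \<and> (\<forall>y\<in>set ys. matched y)"
  using assms(5)
proof (induction "card J" arbitrary: J)
  case 0
  have "finite J" using 0 finite finite_subset unfolding degree_closed_def by blast
  then have "J = {}" using 0 by simp
  then show ?case using assms by (intro exI[of _ "[x, y]"]) (auto simp: gap_def)
next
  case (Suc c)
  have fin: "finite J" using Suc.prems finite finite_subset unfolding degree_closed_def by blast
  have "J \<noteq> {}" using Suc by auto
  have "Max ((\<lambda>i. degree (P i)) ` J) \<in> (\<lambda>i. degree (P i)) ` J"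
    using fin \<open>J \<noteq> {}\<close> by (intro Max_in) auto
  then obtain n where "n \<in> J" "Max ((\<lambda>i. degree (P i)) ` J) = degree (P n)" by auto
  then have n: "n \<in> J" "\<forall>k\<in>J. degree (P k) \<le> degree (P n)"
    using Max_ge[of "(\<lambda>i. degree (P i)) ` J"] fin by fastforce+
  have dc: "degree_closed (J - {n})"
    using Suc.prems n unfolding degree_closed_def by fastforce
  have "c = card (J - {n})" using Suc.hyps n fin by simp
  from Suc.hyps(1)[OF this dc] obtain xs where xs: "xs \<noteq> []" "hd xs = x" "last xs = y"
    "successively (gap (J - {n})) xs" "\<forall>y\<in>set xs. matched y" by blast
  have "n \<in> A" "\<forall>k\<in>A. degree (P k) < degree (P n) \<longrightarrow> k \<in> J - {n}"
    using Suc.prems n unfolding degree_closed_def by auto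
  from refine_chain[OF dc this xs(1,4,5)] show ?case
    using xs(2,3) insert_Diff[OF n(1)] by simp
qed

end

lemma chain_locate:
  fixes f :: "'x \<Rightarrow> 'a::linorder"
  assumes "xs \<noteq> []" "successively R xs" "f (hd xs) \<le> t" "t \<le> f (last xs)"
  shows "(\<exists>x\<in>set xs. f x = t) \<or> (\<exists>x\<in>set xs. \<exists>y\<in>set xs. R x y \<and> f x < t \<and> t < f y)"
  using assms
proof (induction xs rule: induct_list012)
  case (3 x y zs)
  show ?case
  proof (cases "f y \<le> t")
    case True
    then show ?thesis using 3 by auto
  next
    case False
    then show ?thesis using 3 by (cases "f x = t") auto
  qed
qed auto

lemma poly_eventually_ge_pos:
  fixes p :: "'a::linordered_field poly"
  shows "0 < lead_coeff p \<Longrightarrow> \<exists>e>0. eventually (\<lambda>x. e \<le> poly p x) at_top"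
proof (induction p)
  case (pCons c p)
  show ?case
  proof (cases "p = 0")
    case True
    then show ?thesis using pCons.prems by (intro exI[of _ c]) auto
  next
    case False
    then obtain e where e: "e > 0" "eventually (\<lambda>x. e \<le> poly p x) at_top" using pCons by auto
    have "eventually (\<lambda>x. 1 \<le> poly (pCons c p) x) at_top"
      using e(2) eventually_ge_at_top[of 0] eventually_ge_at_top[of "(1 - c) / e"]
    proof eventually_elim
      case (elim x)
      then have "1 - c \<le> x * e" using e(1) by (simp add: field_simps)
      also have "\<dots> \<le> x * poly p x" using elim by (intro mult_left_mono) auto
      finally show ?case by simp
    qed
    then show ?thesis by (intro exI[of _ 1]) auto
  qed
qed auto

lemma poly_eventually_sgn:
  fixes p :: "'a::linordered_field poly"
  shows "eventually (\<lambda>x. sgn (poly p x) = sgn (lead_coeff p)) at_top"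
proof (cases "lead_coeff p" "0::'a" rule: linorder_cases)
  case less
  then have "0 < lead_coeff (- p)" by simp
  from poly_eventually_ge_pos[OF this] obtain e where "e > 0" "eventually (\<lambda>x. e \<le> poly (- p) x) at_top"
    by blast
  then show ?thesis using less by (auto elim!: eventually_mono simp: sgn_if)
next
  case greater
  from poly_eventually_ge_pos[OF this] obtain e where "e > 0" "eventually (\<lambda>x. e \<le> poly p x) at_top"
    by blast
  then show ?thesis using greater by (auto elim!: eventually_mono simp: sgn_if)
qed auto

lemma poly_eventually_sgn_minus:
  fixes p :: "'a::linordered_field poly"
  shows "eventually (\<lambda>x. sgn (poly p (- x)) = sgn ((-1) ^ degree p * lead_coeff p)) at_top"
proof -
  have "lead_coeff (pcompose p [:0, -1:]) = lead_coeff p * lead_coeff [:0, -1:] ^ degree p"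
    by (rule lead_coeff_comp) simp
  then have "lead_coeff (pcompose p [:0, -1:]) = (-1) ^ degree p * lead_coeff p" by simp
  then show ?thesis using poly_eventually_sgn[of "pcompose p [:0, -1:]"] by (simp add: poly_pcompose)
qed

context matched_family begin

lemma sign_transfer:
  "\<exists>s. \<forall>i\<in>A. same_sign (poly (P i) t) (poly (Q i) s)"
proof -
  have "eventually (\<lambda>x. \<bar>t\<bar> < x \<and> (\<forall>i\<in>A. sgn (poly (P i) x) = sgn (lead_coeff (P i)) \<and>
     sgn (poly (P i) (- x)) = sgn ((-1) ^ degree (P i) * lead_coeff (P i)))) at_top"
    using finite poly_eventually_sgn poly_eventually_sgn_minus
    by (intro eventually_conj eventually_gt_at_top eventually_ball_finite ballI) auto
  from eventually_happens'[OF trivial_limit_at_top_linorder this]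
  obtain a where a: "\<bar>t\<bar> < a" "\<And>i. i \<in> A \<Longrightarrow> sgn (poly (P i) a) = sgn (lead_coeff (P i))"
    "\<And>i. i \<in> A \<Longrightarrow> sgn (poly (P i) (- a)) = sgn ((-1) ^ degree (P i) * lead_coeff (P i))"
    by auto
  have "eventually (\<lambda>x. 0 < x \<and> (\<forall>i\<in>A. sgn (poly (Q i) x) = sgn (lead_coeff (Q i)) \<and>
     sgn (poly (Q i) (- x)) = sgn ((-1) ^ degree (Q i) * lead_coeff (Q i)))) at_top"
    using finite poly_eventually_sgn poly_eventually_sgn_minus
    by (intro eventually_conj eventually_gt_at_top eventually_ball_finite ballI) auto
  from eventually_happens'[OF trivial_limit_at_top_linorder this]
  obtain b where b: "0 < b" "\<And>i. i \<in> A \<Longrightarrow> sgn (poly (Q i) b) = sgn (lead_coeff (Q i))"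
    "\<And>i. i \<in> A \<Longrightarrow> sgn (poly (Q i) (- b)) = sgn ((-1) ^ degree (Q i) * lead_coeff (Q i))"
    by auto
  have "matched (a, b)" unfolding matched_def
    using same_sign_sgn_cong[OF a(2) b(2)] lead_same_sign by simp
  moreover have "same_sign ((-1) ^ n * x) ((-1) ^ n * y)" if "same_sign x y"
    for n and x :: 'a and y :: 'b
    using that by (induction n) (auto simp: same_sign_def)
  then have "matched (- a, - b)" unfolding matched_def
    using same_sign_sgn_cong[OF a(3) b(3)] lead_same_sign degree_eq by simp
  moreover have "- a < a" "- b < b" using le_less_trans[OF abs_ge_zero a(1)] b(1) by simp_all
  moreover have "degree_closed A" by (simp add: degree_closed_def)
  ultimately obtain xs where xs: "xs \<noteq> []" "hd xs = (- a, - b)" "last xs = (a, b)"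
      "successively (gap A) xs" "\<forall>x\<in>set xs. matched x"
    using full_chain[of "(- a, - b)" "(a, b)" A] unfolding fst_conv snd_conv by blast
  have "(\<exists>x\<in>set xs. fst x = t) \<or> (\<exists>x\<in>set xs. \<exists>y\<in>set xs. gap A x y \<and> fst x < t \<and> t < fst y)"
    by (rule chain_locate) (use xs a(1) in auto)
  then show ?thesis
  proof
    assume "\<exists>x\<in>set xs. fst x = t"
    then show ?thesis using xs(5) unfolding matched_def by blast
  next
    assume "\<exists>x\<in>set xs. \<exists>y\<in>set xs. gap A x y \<and> fst x < t \<and> t < fst y"
    then obtain x y where xy: "gap A x y" "matched x" "matched y" "fst x < t" "t < fst y"
      using xs(5) by blast
    then have "snd x < snd y" unfolding gap_def by blast
    then obtain s where s: "snd x < s" "s < snd y" using dense by blast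
    have "degree_closed A" by (simp add: degree_closed_def)
    from gap_same_sign_member[OF this xy(1-3) _ xy(4,5) s] show ?thesis by blast
  qed
qed

end

section \<open>Families closed under derivatives and remainders\<close>

locale typed_ring_hom =
  fixes h :: "'a::comm_ring_1 \<Rightarrow> 'b::comm_ring_1"
  assumes hom_add: "h (x + y) = h x + h y"
    and hom_mult: "h (x * y) = h x * h y"
    and hom_1 [simp]: "h 1 = 1"
begin

lemma hom_0 [simp]: "h 0 = 0"
  using hom_add[of 0 0] by simp

lemma hom_uminus: "h (- x) = - h x"
  using hom_add[of x "- x"] by (simp add: eq_neg_iff_add_eq_0 add.commute)

lemma hom_diff: "h (x - y) = h x - h y"
  using hom_add[of x "- y"] by (simp add: hom_uminus)

lemma hom_sum: "h (sum f S) = (\<Sum>x\<in>S. h (f x))"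
  by (induction S rule: infinite_finite_induct) (auto simp: hom_add)

lemma hom_power: "h (x ^ n) = h x ^ n"
  by (induction n) (auto simp: hom_mult)

lemma hom_of_nat: "h (of_nat n) = of_nat n"
  by (induction n) (auto simp: hom_add)

lemma map_poly_hom_add: "map_poly h (p + q) = map_poly h p + map_poly h q"
  by (rule poly_eqI) (simp add: coeff_map_poly hom_add)

lemma map_poly_hom_diff: "map_poly h (p - q) = map_poly h p - map_poly h q"
  by (rule poly_eqI) (simp add: coeff_map_poly hom_diff)

lemma map_poly_hom_mult: "map_poly h (p * q) = map_poly h p * map_poly h q"
  by (rule poly_eqI) (simp add: coeff_map_poly coeff_mult hom_sum hom_mult)

lemma map_poly_hom_smult: "map_poly h (smult c p) = smult (h c) (map_poly h p)"
  by (rule poly_eqI) (simp add: coeff_map_poly hom_mult)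

lemma hom_poly: "h (poly p x) = poly (map_poly h p) (h x)"
  by (induction p) (simp_all add: map_poly_pCons hom_add hom_mult)

lemma degree_map_poly_hom:
  assumes "h (lead_coeff p) \<noteq> 0"
  shows "degree (map_poly h p) = degree p"
proof (rule antisym)
  show "degree (map_poly h p) \<le> degree p"
    by (rule degree_le) (simp add: coeff_map_poly coeff_eq_0)
  show "degree p \<le> degree (map_poly h p)"
    by (rule le_degree) (use assms in \<open>simp add: coeff_map_poly\<close>)
qed

end

text \<open>The library's \<^const>\<open>pderiv\<close> requires a ring without zero divisors.\<close>
definition formal_deriv :: "'a::comm_ring_1 poly \<Rightarrow> 'a poly" where
  "formal_deriv p = (\<Sum>i<degree p. monom (of_nat (Suc i) * coeff p (Suc i)) i)"

lemma coeff_formal_deriv: "coeff (formal_deriv p) i = of_nat (Suc i) * coeff p (Suc i)"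
proof -
  have "coeff (formal_deriv p) i = (\<Sum>k<degree p. if k = i then of_nat (Suc k) * coeff p (Suc k) else 0)"
    by (simp add: formal_deriv_def coeff_sum)
  also have "\<dots> = of_nat (Suc i) * coeff p (Suc i)"
    by (simp add: coeff_eq_0 not_less del: of_nat_Suc)
  finally show ?thesis .
qed

lemma degree_formal_deriv_le: "degree (formal_deriv p) \<le> degree p - 1"
  by (rule degree_le) (auto simp: coeff_formal_deriv coeff_eq_0)

lemma map_poly_formal_deriv:
  fixes h :: "'a::comm_ring_1 \<Rightarrow> 'b::idom"
  assumes "typed_ring_hom h"
  shows "map_poly h (formal_deriv p) = pderiv (map_poly h p)"
proof -
  interpret typed_ring_hom h by fact
  show ?thesis
    by (rule poly_eqI)
      (simp add: coeff_map_poly coeff_pderiv coeff_formal_deriv hom_mult hom_of_nat hom_add)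
qed

definition trunc_poly :: "'a::comm_ring_1 poly \<Rightarrow> 'a poly" where
  "trunc_poly p = p - monom (lead_coeff p) (degree p)"

lemma degree_trunc_poly: "degree p > 0 \<Longrightarrow> degree (trunc_poly p) < degree p"
proof -
  assume d: "degree p > 0"
  have "degree (trunc_poly p) \<le> degree p - 1"
    unfolding trunc_poly_def by (rule degree_le) (use d in \<open>auto simp: coeff_eq_0 Suc_le_eq\<close>)
  then show ?thesis using d by simp
qed

lemma trunc_poly_const: "degree p = 0 \<Longrightarrow> trunc_poly p = 0"
  unfolding trunc_poly_def by (metis coeff_pCons_0 degree_eq_zeroE diff_self monom_0)

text \<open>The multiplier is an even power of the leading coefficient, hence positive after
  evaluation, so that remainders preserve signs at the roots of \<^term>\<open>g\<close>.\<close>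
definition even_pseudo_rem :: "'a::comm_ring_1 poly \<Rightarrow> 'a poly \<Rightarrow> 'a poly \<Rightarrow> bool" where
  "even_pseudo_rem f g r \<longleftrightarrow> degree r < degree g \<and>
     (\<exists>n u. smult (lead_coeff g ^ (2 * n)) f = g * u + r)"

definition poly_over :: "'a::comm_ring_1 set \<Rightarrow> 'a poly set" where
  "poly_over R = {p. \<forall>i. coeff p i \<in> R}"

locale subring_set =
  fixes R :: "'a::comm_ring_1 set"
  assumes one_in: "1 \<in> R" and add_in: "x \<in> R \<Longrightarrow> y \<in> R \<Longrightarrow> x + y \<in> R"
    and mult_in: "x \<in> R \<Longrightarrow> y \<in> R \<Longrightarrow> x * y \<in> R" and uminus_in: "x \<in> R \<Longrightarrow> - x \<in> R"
begin

lemma zero_in: "0 \<in> R"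
  using add_in[OF one_in uminus_in[OF one_in]] by simp

lemma diff_in: "x \<in> R \<Longrightarrow> y \<in> R \<Longrightarrow> x - y \<in> R"
  using add_in[OF _ uminus_in] by fastforce

lemma sum_in: "(\<And>x. x \<in> S \<Longrightarrow> f x \<in> R) \<Longrightarrow> sum f S \<in> R"
  by (induction S rule: infinite_finite_induct) (auto simp: zero_in add_in)

lemma power_in: "x \<in> R \<Longrightarrow> x ^ n \<in> R"
  by (induction n) (auto simp: one_in mult_in)

lemma of_nat_in: "of_nat n \<in> R"
  by (induction n) (auto simp: one_in zero_in add_in)

lemma poly_over_subring: "subring_set (poly_over R)"
  by standard (auto simp: poly_over_def coeff_mult one_in zero_in add_in uminus_in
      intro!: sum_in mult_in)

lemma poly_over_monom: "c \<in> R \<Longrightarrow> monom c n \<in> poly_over R"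
  by (auto simp: poly_over_def zero_in)

lemma poly_over_smult: "c \<in> R \<Longrightarrow> p \<in> poly_over R \<Longrightarrow> smult c p \<in> poly_over R"
  by (auto simp: poly_over_def mult_in)

lemma poly_over_formal_deriv: "p \<in> poly_over R \<Longrightarrow> formal_deriv p \<in> poly_over R"
  by (auto simp: poly_over_def coeff_formal_deriv intro!: mult_in of_nat_in[of "Suc _", simplified])

lemma lead_coeff_in: "p \<in> poly_over R \<Longrightarrow> lead_coeff p \<in> R"
  by (simp add: poly_over_def)

lemma poly_over_trunc: "p \<in> poly_over R \<Longrightarrow> trunc_poly p \<in> poly_over R"
  unfolding trunc_poly_def
  by (intro subring_set.diff_in[OF poly_over_subring] poly_over_monom lead_coeff_in)

lemma even_pseudo_rem_exists:
  assumes "f \<in> poly_over R" "g \<in> poly_over R" "degree g > 0"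
  shows "\<exists>r\<in>poly_over R. even_pseudo_rem f g r"
  using assms(1)
proof (induction "degree f" arbitrary: f rule: less_induct)
  case less
  interpret P: subring_set "poly_over R" by (rule poly_over_subring)
  show ?case
  proof (cases "degree f < degree g")
    case True
    then show ?thesis using less.prems unfolding even_pseudo_rem_def
      by (intro bexI[of _ f] conjI exI[of _ 0]) auto
  next
    case False
    define a b d where "a = lead_coeff g" and "b = lead_coeff f" and "d = degree f - degree g"
    have ab: "a \<in> R" "b \<in> R" using assms(2) less.prems by (auto simp: a_def b_def lead_coeff_in)
    define f' where "f' = smult (a ^ 2) f - g * monom (a * b) d"
    have f': "f' \<in> poly_over R"
      unfolding f'_def using ab assms(2) less.prems
      by (intro P.diff_in P.mult_in poly_over_smult poly_over_monom power_in mult_in)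
    have cm: "coeff (g * monom (a * b) d) i = (if i < d then 0 else a * b * coeff g (i - d))" for i
      unfolding mult.commute[of g] coeff_monom_mult by simp
    have cf: "coeff f' i = a ^ 2 * coeff f i - (if i < d then 0 else a * b * coeff g (i - d))" for i
      unfolding f'_def coeff_diff coeff_smult cm ..
    have "coeff f' i = 0" if "i > degree f - 1" for i
    proof (cases "i = degree f")
      case True
      then show ?thesis using False
        by (simp add: cf d_def a_def b_def power2_eq_square mult_ac)
    next
      case i: False
      then have "i > degree f" "i - d > degree g" using that False by (auto simp: d_def)
      then show ?thesis by (simp add: cf coeff_eq_0)
    qed
    then have "degree f' \<le> degree f - 1" by (intro degree_le) auto
    then have "degree f' < degree f" using False assms(3) by linarith
    from less.hyps[OF this f'] obtain r n u where r: "r \<in> poly_over R" "degree r < degree g"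
      "smult (a ^ (2 * n)) f' = g * u + r"
      unfolding even_pseudo_rem_def a_def by blast
    have "smult (a ^ (2 * Suc n)) f = smult (a ^ (2 * n)) (f' + g * monom (a * b) d)"
      by (simp add: f'_def power_add power2_eq_square mult_ac)
    also have "\<dots> = g * (u + smult (a ^ (2 * n)) (monom (a * b) d)) + r"
      unfolding smult_add_right r(3) by (simp add: distrib_left add_ac)
    finally show ?thesis using r unfolding even_pseudo_rem_def a_def by blast
  qed
qed

end

definition trunc_deriv_closed :: "'a::comm_ring_1 poly set \<Rightarrow> bool" where
  "trunc_deriv_closed S \<longleftrightarrow> (\<forall>p\<in>S. trunc_poly p \<in> S \<and> formal_deriv p \<in> S)"

definition rem_closed_above :: "nat \<Rightarrow> 'a::comm_ring_1 poly set \<Rightarrow> bool" where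
  "rem_closed_above e S \<longleftrightarrow> (\<forall>f\<in>S. \<forall>g\<in>S. e < degree g \<longrightarrow> degree g \<le> degree f \<longrightarrow>
     (\<exists>r\<in>S. even_pseudo_rem f g r))"

context subring_set begin

lemma trunc_deriv_closure:
  "finite S \<Longrightarrow> S \<subseteq> poly_over R \<Longrightarrow> \<forall>p\<in>S. degree p \<le> D \<Longrightarrow>
    \<exists>S'. finite S' \<and> S \<subseteq> S' \<and> S' \<subseteq> poly_over R \<and> (\<forall>p\<in>S'. degree p \<le> D) \<and> trunc_deriv_closed S'"
proof (induction D arbitrary: S)
  case 0
  have "trunc_poly p = 0" "formal_deriv p = 0" if "degree p = 0" for p :: "'a poly"
    using that trunc_poly_const[of p] by (auto simp: formal_deriv_def)
  then have "trunc_deriv_closed (insert 0 S)"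
    using 0 unfolding trunc_deriv_closed_def by auto
  then show ?case using 0 zero_in
    by (intro exI[of _ "insert 0 S"]) (auto simp: poly_over_def)
next
  case (Suc D)
  define S1 where "S1 = {p\<in>S. degree p \<le> D} \<union> trunc_poly ` S \<union> formal_deriv ` S"
  have d1: "degree (trunc_poly p) \<le> D" "degree (formal_deriv p) \<le> D" if "p \<in> S" for p
  proof -
    have p: "degree p \<le> Suc D" using Suc.prems that by blast
    then show "degree (formal_deriv p) \<le> D" using degree_formal_deriv_le[of p] by simp
    show "degree (trunc_poly p) \<le> D"
      using degree_trunc_poly[of p] trunc_poly_const[of p] p by (cases "degree p = 0") auto
  qed
  have "finite S1" "S1 \<subseteq> poly_over R" "\<forall>p\<in>S1. degree p \<le> D"
    using Suc.prems d1 poly_over_trunc poly_over_formal_deriv by (auto simp: S1_def)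
  from Suc.IH[OF this] obtain S' where S': "finite S'" "S1 \<subseteq> S'" "S' \<subseteq> poly_over R"
    "\<forall>p\<in>S'. degree p \<le> D" "trunc_deriv_closed S'" by blast
  have "trunc_deriv_closed (S \<union> S')"
    using S'(2,5) unfolding trunc_deriv_closed_def S1_def by blast
  moreover have "\<forall>p\<in>S \<union> S'. degree p \<le> Suc D" using S' Suc.prems by (auto simp: le_SucI)
  ultimately show ?case using S' Suc.prems by (intro exI[of _ "S \<union> S'"]) auto
qed

lemma rem_closure_step:
  assumes "finite S" "S \<subseteq> poly_over R" "\<forall>p\<in>S. degree p \<le> D" "trunc_deriv_closed S" "k \<le> D"
  shows "\<exists>S'. finite S' \<and> S \<subseteq> S' \<and> S' \<subseteq> poly_over R \<and> (\<forall>p\<in>S'. degree p \<le> D) \<and>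
    trunc_deriv_closed S' \<and> rem_closed_above (D - k) S'"
  using assms(5)
proof (induction k)
  case 0
  then show ?case using assms(1-4) by (intro exI[of _ S]) (auto simp: rem_closed_above_def)
next
  case (Suc k)
  then obtain S' where S': "finite S'" "S \<subseteq> S'" "S' \<subseteq> poly_over R" "\<forall>p\<in>S'. degree p \<le> D"
    "trunc_deriv_closed S'" "rem_closed_above (D - k) S'" by auto
  define e where "e = D - k"
  have e: "D - Suc k = e - 1" "e > 0" "e \<le> D" using Suc.prems by (auto simp: e_def)
  define rm where "rm = (\<lambda>(f, g). SOME r. r \<in> poly_over R \<and> even_pseudo_rem f g r)"
  have rm: "rm (f, g) \<in> poly_over R \<and> even_pseudo_rem f g (rm (f, g))"
    if "f \<in> S'" "g \<in> S'" "degree g = e" for f g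
    unfolding rm_def split_conv
    by (rule someI_ex) (use even_pseudo_rem_exists[of f g] S'(3) that e in auto)
  define N where "N = rm ` (S' \<times> {g\<in>S'. degree g = e})"
  have N1: "finite N" using S'(1) by (simp add: N_def)
  have N2: "N \<subseteq> poly_over R" using rm by (auto simp: N_def)
  have "degree r \<le> e - 1" if rN: "r \<in> N" for r
  proof -
    obtain f g where fg: "f \<in> S'" "g \<in> S'" "degree g = e" "r = rm (f, g)"
      using rN unfolding N_def by auto
    then have "degree r < e" using rm[OF fg(1-3)] unfolding even_pseudo_rem_def by simp
    then show ?thesis by linarith
  qed
  then have "\<forall>p\<in>N. degree p \<le> e - 1" by blast
  from trunc_deriv_closure[OF N1 N2 this] obtain N' where N': "finite N'" "N \<subseteq> N'" "N' \<subseteq> poly_over R" "\<forall>p\<in>N'. degree p \<le> e - 1"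
    "trunc_deriv_closed N'" by blast
  have "rem_closed_above (e - 1) (S' \<union> N')"
    unfolding rem_closed_above_def
  proof (intro ballI impI)
    fix f g assume fg: "f \<in> S' \<union> N'" "g \<in> S' \<union> N'" "e - 1 < degree g" "degree g \<le> degree f"
    then have S: "f \<in> S'" "g \<in> S'" using N'(4) by fastforce+
    show "\<exists>r\<in>S' \<union> N'. even_pseudo_rem f g r"
    proof (cases "degree g = e")
      case True
      then have "rm (f, g) \<in> N" using S unfolding N_def by blast
      then show ?thesis using rm[OF S True] N'(2) by blast
    next
      case False
      then have "D - k < degree g" using fg(3) e(2) by (simp add: e_def)
      then show ?thesis using S'(6) S fg(4) unfolding rem_closed_above_def by blast
    qed
  qed
  moreover have "trunc_deriv_closed (S' \<union> N')"
    using S'(5) N'(5) unfolding trunc_deriv_closed_def by blast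
  moreover have "\<forall>p\<in>S' \<union> N'. degree p \<le> D" using S'(4) N'(4) e by fastforce
  ultimately show ?case using S' N' e by (intro exI[of _ "S' \<union> N'"]) auto
qed

lemma rem_closure:
  assumes "finite S" "S \<subseteq> poly_over R"
  shows "\<exists>S'. finite S' \<and> S \<subseteq> S' \<and> S' \<subseteq> poly_over R \<and> trunc_deriv_closed S' \<and> rem_closed_above 0 S'"
proof -
  define D where "D = Max (insert 0 (degree ` S))"
  have "\<forall>p\<in>S. degree p \<le> D" using assms(1) by (auto simp: D_def)
  from trunc_deriv_closure[OF assms this] obtain S' where S': "finite S'" "S \<subseteq> S'"
    "S' \<subseteq> poly_over R" "\<forall>p\<in>S'. degree p \<le> D" "trunc_deriv_closed S'" by blast
  from rem_closure_step[OF S'(1,3,4,5) order_refl] show ?thesis using S'(2)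
    by (metis diff_self_eq_0 subset_trans)
qed

end

lemma closed_family_sign_transfer:
  fixes h1 :: "'c::comm_ring_1 \<Rightarrow> 'a::rcf" and h2 :: "'c \<Rightarrow> 'b::rcf"
  assumes h1: "typed_ring_hom h1" and h2: "typed_ring_hom h2"
    and S: "finite S" "trunc_deriv_closed S" "rem_closed_above 0 S"
    and signs: "\<And>p. p \<in> S \<Longrightarrow> same_sign (h1 (lead_coeff p)) (h2 (lead_coeff p))"
  shows "\<exists>s. \<forall>p\<in>S. same_sign (poly (map_poly h1 p) t) (poly (map_poly h2 p) s)"
proof -
  interpret h1: typed_ring_hom h1 by fact
  interpret h2: typed_ring_hom h2 by fact
  define A where "A = {p\<in>S. p = 0 \<or> h1 (lead_coeff p) \<noteq> 0}"
  have h12: "h1 (lead_coeff p) = 0 \<longleftrightarrow> h2 (lead_coeff p) = 0" if "p \<in> S" for p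
    using same_sign_zero_iff[OF signs[OF that]] .
  have deg1: "degree (map_poly h1 p) = degree p" if "p \<in> A" for p
    using that h1.degree_map_poly_hom[of p] by (auto simp: A_def)
  have deg2: "degree (map_poly h2 p) = degree p" if "p \<in> A" for p
    using that h2.degree_map_poly_hom[of p] h12 by (auto simp: A_def)
  have reduce: "\<exists>p'\<in>A. map_poly h1 p' = map_poly h1 p \<and> map_poly h2 p' = map_poly h2 p"
    if "p \<in> S" for p using that
  proof (induction "degree p" arbitrary: p rule: less_induct)
    case less
    show ?case
    proof (cases "p = 0 \<or> h1 (lead_coeff p) \<noteq> 0")
      case True
      then show ?thesis using less.prems by (auto simp: A_def)
    next
      case False
      then have "h1 (lead_coeff p) = 0" "h2 (lead_coeff p) = 0" using h12 less.prems by auto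
      then have eq: "map_poly h1 (trunc_poly p) = map_poly h1 p" "map_poly h2 (trunc_poly p) = map_poly h2 p"
        unfolding trunc_poly_def h1.map_poly_hom_diff h2.map_poly_hom_diff
        by (simp_all add: map_poly_monom)
      have T: "trunc_poly p \<in> S" using S(2) less.prems unfolding trunc_deriv_closed_def by blast
      show ?thesis
      proof (cases "degree p = 0")
        case True
        then have "trunc_poly p \<in> A" using trunc_poly_const[of p] T by (simp add: A_def)
        then show ?thesis using eq by metis
      next
        case False
        then show ?thesis using less.hyps[OF _ T] degree_trunc_poly[of p] eq by simp
      qed
    qed
  qed
  interpret matched_family A "map_poly h1" "map_poly h2"
  proof
    show "finite A" using S(1) by (simp add: A_def)
  next
    fix p assume p: "p \<in> A"
    then show "degree (map_poly h1 p) = degree (map_poly h2 p)" using deg1 deg2 by simp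
    show "same_sign (lead_coeff (map_poly h1 p)) (lead_coeff (map_poly h2 p))"
      using p signs[of p] deg1 deg2 by (auto simp: coeff_map_poly A_def)
    assume "0 < degree (map_poly h1 p)"
    then have d: "0 < degree p" using p deg1 by simp
    have "coeff (formal_deriv p) (degree p - 1) = of_nat (degree p) * lead_coeff p"
      using d by (simp add: coeff_formal_deriv)
    then have c: "h1 (coeff (formal_deriv p) (degree p - 1)) \<noteq> 0"
      using p d by (auto simp: h1.hom_mult h1.hom_of_nat A_def)
    then have "degree p - 1 \<le> degree (formal_deriv p)" by (intro le_degree) auto
    then have "degree (formal_deriv p) = degree p - 1" using degree_formal_deriv_le[of p] by simp
    then have "formal_deriv p \<in> A" using c p S(2) by (auto simp: A_def trunc_deriv_closed_def)
    then show "\<exists>k\<in>A. map_poly h1 k = pderiv (map_poly h1 p) \<and> map_poly h2 k = pderiv (map_poly h2 p)"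
      using map_poly_formal_deriv[OF h1] map_poly_formal_deriv[OF h2] by blast
  next
    fix f g assume fg: "f \<in> A" "g \<in> A" "0 < degree (map_poly h1 g)"
      "degree (map_poly h1 g) \<le> degree (map_poly h1 f)"
    then have d: "0 < degree g" "degree g \<le> degree f" using deg1 by auto
    then obtain r where r: "r \<in> S" "even_pseudo_rem f g r"
      using S(3) fg unfolding rem_closed_above_def A_def by blast
    obtain n u where u: "smult (lead_coeff g ^ (2 * n)) f = g * u + r" and dr: "degree r < degree g"
      using r(2) unfolding even_pseudo_rem_def by blast
    obtain k where k: "k \<in> A" "map_poly h1 k = map_poly h1 r" "map_poly h2 k = map_poly h2 r"
      using reduce[OF r(1)] by blast
    have nz: "h1 (lead_coeff g) \<noteq> 0" "h2 (lead_coeff g) \<noteq> 0"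
      using fg(2) d h12 by (auto simp: A_def)
    have "smult (h1 (lead_coeff g) ^ (2 * n)) (map_poly h1 f) = map_poly h1 g * map_poly h1 u + map_poly h1 k"
      "smult (h2 (lead_coeff g) ^ (2 * n)) (map_poly h2 f) = map_poly h2 g * map_poly h2 u + map_poly h2 k"
      using arg_cong[OF u, of "map_poly h1"] arg_cong[OF u, of "map_poly h2"] k
      by (simp_all add: h1.map_poly_hom_smult h2.map_poly_hom_smult h1.hom_power h2.hom_power
          h1.map_poly_hom_add h2.map_poly_hom_add h1.map_poly_hom_mult h2.map_poly_hom_mult)
    moreover have "degree (map_poly h1 k) < degree (map_poly h1 g)"
    proof -
      have "degree (map_poly h1 r) \<le> degree r"
        by (rule degree_le) (simp add: coeff_map_poly coeff_eq_0)
      then show ?thesis using k dr deg1 fg(2) by simp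
    qed
    moreover have "0 < h1 (lead_coeff g) ^ (2 * n)" "0 < h2 (lead_coeff g) ^ (2 * n)"
      using nz by (simp_all add: power_mult)
    ultimately show "\<exists>k\<in>A. \<exists>c d u v. 0 < c \<and> 0 < d \<and>
        smult c (map_poly h1 f) = map_poly h1 g * u + map_poly h1 k \<and>
        smult d (map_poly h2 f) = map_poly h2 g * v + map_poly h2 k \<and>
        degree (map_poly h1 k) < degree (map_poly h1 g)"
      using k(1) by blast
  qed
  obtain s where "\<forall>p\<in>A. same_sign (poly (map_poly h1 p) t) (poly (map_poly h2 p) s)"
    using sign_transfer by blast
  then show ?thesis using reduce by metis
qed

section \<open>Hilbert's basis theorem\<close>

definition ideal_of :: "'a::comm_ring_1 set \<Rightarrow> 'a set \<Rightarrow> bool" where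
  "ideal_of R J \<longleftrightarrow> J \<subseteq> R \<and> 0 \<in> J \<and> (\<forall>a\<in>J. \<forall>b\<in>J. a + b \<in> J) \<and> (\<forall>r\<in>R. \<forall>a\<in>J. r * a \<in> J)"

definition noetherian_set :: "'a::comm_ring_1 set \<Rightarrow> bool" where
  "noetherian_set R \<longleftrightarrow> (\<forall>J. ideal_of R J \<longrightarrow>
     (\<exists>G. finite G \<and> G \<subseteq> J \<and> (\<forall>K. ideal_of R K \<longrightarrow> G \<subseteq> K \<longrightarrow> J \<subseteq> K)))"

lemma noetherian_setD:
  "noetherian_set R \<Longrightarrow> ideal_of R J \<Longrightarrow>
    \<exists>G. finite G \<and> G \<subseteq> J \<and> (\<forall>K. ideal_of R K \<longrightarrow> G \<subseteq> K \<longrightarrow> J \<subseteq> K)"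
  by (simp add: noetherian_set_def)

lemma Hilbert_basis:
  assumes R: "subring_set R" and noeth: "noetherian_set R"
  shows "noetherian_set (poly_over R)"
  unfolding noetherian_set_def
proof (intro allI impI)
  interpret subring_set R by fact
  fix J assume J: "ideal_of (poly_over R) J"
  note Jd = J[unfolded ideal_of_def]
  have JR: "coeff p i \<in> R" if "p \<in> J" for p i using Jd that unfolding poly_over_def by blast
  define L where "L n = {b. \<exists>p\<in>J. degree p \<le> n \<and> coeff p n = b}" for n
  have Lid: "ideal_of R (L n)" for n
    unfolding ideal_of_def
  proof (intro conjI ballI)
    show "L n \<subseteq> R" using JR by (auto simp: L_def)
    show "0 \<in> L n" using Jd by (auto simp: L_def intro!: bexI[of _ 0])
    show "a + b \<in> L n" if ab: "a \<in> L n" "b \<in> L n" for a b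
    proof -
      obtain p q where "p \<in> J" "q \<in> J" "degree p \<le> n" "degree q \<le> n" "coeff p n = a" "coeff q n = b"
        using ab unfolding L_def by blast
      then show ?thesis using Jd unfolding L_def
        by (intro CollectI bexI[of _ "p + q"]) (auto intro: degree_add_le)
    qed
    show "r * a \<in> L n" if ra: "r \<in> R" "a \<in> L n" for r a
    proof -
      obtain p where p: "p \<in> J" "degree p \<le> n" "coeff p n = a"
        using ra unfolding L_def by blast
      have "monom r 0 * p \<in> J" using Jd p(1) poly_over_monom[OF ra(1)] by blast
      then have "smult r p \<in> J" by (simp add: monom_0)
      then show ?thesis using p degree_smult_le[of r p] unfolding L_def
        by (intro CollectI bexI[of _ "smult r p"]) auto
    qed
  qed
  have Lshift: "\<exists>q\<in>J. degree q \<le> m \<and> coeff q m = b" if nm: "n \<le> m" "b \<in> L n" for n m b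
  proof -
    obtain p where p: "p \<in> J" "degree p \<le> n" "coeff p n = b" using nm(2) unfolding L_def by blast
    have "monom 1 (m - n) * p \<in> J" using Jd p(1) poly_over_monom[OF one_in] by blast
    moreover have "degree (monom 1 (m - n) * p) \<le> m"
      using degree_mult_le[of "monom 1 (m - n)" p] degree_monom_le[of "1::'a" "m - n"] p(2) nm(1) by linarith
    ultimately show ?thesis using p nm(1)
      by (intro bexI[of _ "monom 1 (m - n) * p"]) (auto simp: coeff_monom_mult)
  qed
  then have Lmono: "L n \<subseteq> L m" if "n \<le> m" for n m using that unfolding L_def by blast
  define M where "M = (\<Union>n. L n)"
  have "ideal_of R M"
    unfolding ideal_of_def
  proof (intro conjI ballI)
    show "M \<subseteq> R" using Lid unfolding M_def ideal_of_def by blast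
    show "0 \<in> M" using Lid unfolding M_def ideal_of_def by blast
    show "a + b \<in> M" if ab: "a \<in> M" "b \<in> M" for a b
    proof -
      obtain n m where "a \<in> L n" "b \<in> L m" using ab unfolding M_def by blast
      then have "a \<in> L (max n m)" "b \<in> L (max n m)" using Lmono[of n "max n m"] Lmono[of m "max n m"] by auto
      then show ?thesis using Lid unfolding M_def ideal_of_def by blast
    qed
    show "r * a \<in> M" if "r \<in> R" "a \<in> M" for r a
      using that Lid unfolding M_def ideal_of_def by blast
  qed
  from noetherian_setD[OF noeth this]
  obtain G where G: "finite G" "G \<subseteq> M" "\<And>K. ideal_of R K \<Longrightarrow> G \<subseteq> K \<Longrightarrow> M \<subseteq> K" by blast
  have "\<exists>D. G \<subseteq> L D" using G(1,2)
  proof (induction G rule: finite_induct)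
    case (insert x F)
    then obtain D n where "F \<subseteq> L D" "x \<in> L n" unfolding M_def by auto
    then have "insert x F \<subseteq> L (max D n)" using Lmono[of D "max D n"] Lmono[of n "max D n"] by auto
    then show ?case by blast
  qed auto
  then obtain D where "G \<subseteq> L D" by blast
  then have MD: "M \<subseteq> L D" using G(3) Lid by blast
  from noetherian_setD[OF noeth Lid]
  have "\<forall>n. \<exists>G. finite G \<and> G \<subseteq> L n \<and> (\<forall>K. ideal_of R K \<longrightarrow> G \<subseteq> K \<longrightarrow> L n \<subseteq> K)" by blast
  from choice[OF this] obtain Gn where Gn': "\<forall>n. finite (Gn n) \<and> Gn n \<subseteq> L n \<and>
      (\<forall>K. ideal_of R K \<longrightarrow> Gn n \<subseteq> K \<longrightarrow> L n \<subseteq> K)" by (elim exE)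
  have Gn: "finite (Gn n)" "Gn n \<subseteq> L n" "\<And>K. ideal_of R K \<Longrightarrow> Gn n \<subseteq> K \<Longrightarrow> L n \<subseteq> K" for n
    using Gn'[rule_format, of n] by blast+
  define lift where "lift n b = (SOME p. p \<in> J \<and> degree p \<le> n \<and> coeff p n = b)" for n b
  have lift: "lift n b \<in> J \<and> degree (lift n b) \<le> n \<and> coeff (lift n b) n = b" if "b \<in> L n" for n b
    unfolding lift_def by (rule someI_ex) (use that in \<open>auto simp: L_def\<close>)
  define gens where "gens = (\<Union>n\<in>{..D}. lift n ` Gn n)"
  have "finite gens" using Gn(1) by (simp add: gens_def)
  moreover have "gens \<subseteq> J" using lift Gn(2) unfolding gens_def by blast
  moreover have "J \<subseteq> K" if K: "ideal_of (poly_over R) K" "gens \<subseteq> K" for K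
  proof -
    note Kd = K(1)[unfolded ideal_of_def]
    have KJ: "\<exists>q. q \<in> K \<and> q \<in> J \<and> degree q \<le> n \<and> coeff q n = b" if n: "n \<le> D" "b \<in> L n" for n b
    proof -
      define B where "B = {b. \<exists>q. q \<in> K \<and> q \<in> J \<and> degree q \<le> n \<and> coeff q n = b}"
      have "ideal_of R B"
        unfolding ideal_of_def
      proof (intro conjI ballI)
        show "B \<subseteq> R" using JR by (auto simp: B_def)
        show "0 \<in> B" using Jd Kd by (auto simp: B_def intro!: exI[of _ 0])
        show "a + b \<in> B" if ab: "a \<in> B" "b \<in> B" for a b
        proof -
          obtain p q where "p \<in> J" "q \<in> J" "p \<in> K" "q \<in> K" "degree p \<le> n" "degree q \<le> n"
            "coeff p n = a" "coeff q n = b"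
            using ab unfolding B_def by blast
          then show ?thesis using Jd Kd unfolding B_def
            by (intro CollectI exI[of _ "p + q"]) (auto intro: degree_add_le)
        qed
        show "r * a \<in> B" if ra: "r \<in> R" "a \<in> B" for r a
        proof -
          obtain p where p: "p \<in> J" "p \<in> K" "degree p \<le> n" "coeff p n = a"
            using ra unfolding B_def by blast
          have "monom r 0 * p \<in> J" "monom r 0 * p \<in> K"
            using Jd Kd p(1,2) poly_over_monom[OF ra(1)] by blast+
          then have "smult r p \<in> J" "smult r p \<in> K" by (simp_all add: monom_0)
          then show ?thesis using p degree_smult_le[of r p] unfolding B_def
            by (intro CollectI exI[of _ "smult r p"]) auto
        qed
      qed
      moreover have "Gn n \<subseteq> B"
      proof
        fix g assume g: "g \<in> Gn n"
        then have "lift n g \<in> K" using K(2) n(1) unfolding gens_def by blast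
        then show "g \<in> B" using lift[of g n] g Gn(2) unfolding B_def by blast
      qed
      ultimately have "L n \<subseteq> B" by (rule Gn(3))
      then show ?thesis using n(2) unfolding B_def by blast
    qed
    have "p \<in> K" if "p \<in> J" "\<forall>i\<ge>N. coeff p i = 0" for N p
      using that
    proof (induction N arbitrary: p)
      case 0
      then have "p = 0" by (intro poly_eqI) auto
      then show ?case using Kd by blast
    next
      case (Suc N)
      define n where "n = min N D"
      have "degree p \<le> N" using Suc.prems(2) by (intro degree_le) auto
      then have "coeff p N \<in> L N" using Suc.prems(1) unfolding L_def by blast
      then have "coeff p N \<in> L n"
        using MD unfolding n_def M_def by (cases "N \<le> D") (auto simp: min_def)
      then obtain q where q: "q \<in> K" "q \<in> J" "degree q \<le> n" "coeff q n = coeff p N"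
        using KJ[of n] unfolding n_def by auto
      define q' where "q' = monom 1 (N - n) * q"
      have q': "q' \<in> K" "q' \<in> J" using Jd Kd q(1,2) poly_over_monom[OF one_in] unfolding q'_def by blast+
      have uq: "- q' \<in> J" using Jd q'(2) poly_over_monom[OF uminus_in[OF one_in], of 0]
        by (metis monom_0 mult_minus_left mult_1 one_pCons minus_monom)
      have "coeff (p - q') i = 0" if "i \<ge> N" for i
      proof (cases "i = N")
        case True
        then show ?thesis using q(4) by (simp add: q'_def coeff_monom_mult n_def)
      next
        case False
        then have "coeff q (i - (N - n)) = 0" using that q(3) by (intro coeff_eq_0) (auto simp: n_def)
        then show ?thesis using that False Suc.prems(2) by (simp add: q'_def coeff_monom_mult)
      qed
      moreover have "p - q' \<in> J" using Jd Suc.prems(1) uq by (metis diff_conv_add_uminus)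
      ultimately have "p - q' \<in> K" using Suc.IH by blast
      then have "(p - q') + q' \<in> K" using Kd q'(1) by blast
      then show ?case by simp
    qed
    then show ?thesis using coeff_eq_0 by (metis Suc_le_lessD subsetI)
  qed
  ultimately show "\<exists>G. finite G \<and> G \<subseteq> J \<and> (\<forall>K. ideal_of (poly_over R) K \<longrightarrow> G \<subseteq> K \<longrightarrow> J \<subseteq> K)"
    by blast
qed

section \<open>Polynomials in several variables\<close>

lemma poly_mapping_add_induct [case_names zero add]:
  fixes f :: "'a \<Rightarrow>\<^sub>0 'b::monoid_add"
  assumes "P 0" "\<And>f k v. P f \<Longrightarrow> P (f + Poly_Mapping.single k v)"
  shows "P f"
proof (induction f rule: update_induct)
  case (update f a b)
  then have "Poly_Mapping.update a b f = f + Poly_Mapping.single a b"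
    by (intro poly_mapping_eqI)
      (auto simp: lookup_add lookup_update lookup_single in_keys_iff)
  then show ?case using assms(2)[OF update(3)] by simp
qed (rule assms(1))

abbreviation rconst :: "real \<Rightarrow> 'n rpoly" where
  "rconst r \<equiv> Poly_Mapping.single 0 r"

definition rvar :: "'n \<Rightarrow> 'n rpoly" where
  "rvar i = Poly_Mapping.single (Poly_Mapping.single i 1) 1"

lemma eval_single: "eval (Poly_Mapping.single m c) x = c * (\<Prod>i\<in>UNIV. (x $ i) ^ Poly_Mapping.lookup m i)"
  by (simp add: Defs.eval_def)

lemma eval_add: "eval (p + q) x = eval p x + eval q x"
  unfolding Defs.eval_def
  by (rule setsum_keys_plus_distrib) (auto simp: algebra_simps)

lemma eval_0 [simp]: "eval 0 x = 0"
  by (simp add: Defs.eval_def)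

lemma eval_mult: "eval (p * q) x = eval p x * eval q x"
proof (induction p rule: poly_mapping_add_induct)
  case (add p m c)
  have "eval (Poly_Mapping.single m c * q) x = eval (Poly_Mapping.single m c) x * eval q x"
  proof (induction q rule: poly_mapping_add_induct)
    case (add q m' c')
    have "eval (Poly_Mapping.single m c * Poly_Mapping.single m' c') x =
        eval (Poly_Mapping.single m c) x * eval (Poly_Mapping.single m' c') x"
      by (simp add: mult_single eval_single lookup_add power_add prod.distrib)
    then show ?case using add by (simp add: distrib_left eval_add)
  qed simp
  then show ?case using add by (simp add: distrib_right eval_add)
qed simp

lemma eval_rconst [simp]: "eval (rconst r) x = r"
  by (simp add: eval_single)

lemma eval_1 [simp]: "eval 1 x = 1"
  using eval_rconst[of 1] by (simp del: eval_rconst)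

lemma eval_rvar [simp]: "eval (rvar i) x = x $ i"
proof -
  have "(\<Prod>j\<in>UNIV. (x $ j) ^ Poly_Mapping.lookup (Poly_Mapping.single i 1) j) =
      (\<Prod>j\<in>UNIV. if j = i then x $ j else 1)"
    by (rule prod.cong) (auto simp: lookup_single)
  then show ?thesis by (simp add: rvar_def eval_single)
qed

lemma eval_hom: "typed_ring_hom (\<lambda>p. eval p x)"
  by standard (simp_all add: eval_add eval_mult)

inductive_set polys_in :: "'n set \<Rightarrow> 'n rpoly set" for V where
  const: "rconst r \<in> polys_in V"
| var: "i \<in> V \<Longrightarrow> rvar i \<in> polys_in V"
| add: "p \<in> polys_in V \<Longrightarrow> q \<in> polys_in V \<Longrightarrow> p + q \<in> polys_in V"
| mult: "p \<in> polys_in V \<Longrightarrow> q \<in> polys_in V \<Longrightarrow> p * q \<in> polys_in V"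

lemma polys_in_subring: "subring_set (polys_in V)"
proof
  show "1 \<in> polys_in V" using polys_in.const[of 1] by simp
  show "- p \<in> polys_in V" if "p \<in> polys_in V" for p
    using polys_in.mult[OF polys_in.const[of "-1"] that] by (simp add: single_uminus)
qed (auto intro: polys_in.intros)

lemma polys_in_UNIV: "p \<in> polys_in UNIV"
proof (induction p rule: poly_mapping_add_induct)
  case zero
  show ?case using polys_in.const[of 0] by simp
next
  case (add p m c)
  interpret subring_set "polys_in UNIV" by (rule polys_in_subring)
  have "Poly_Mapping.single m 1 \<in> polys_in UNIV" for m :: "'a \<Rightarrow>\<^sub>0 nat"
  proof (induction m rule: poly_mapping_add_induct)
    case zero
    show ?case by (rule polys_in.const)
  next
    case (add m i k)
    have "Poly_Mapping.single (Poly_Mapping.single i k) 1 = rvar i ^ k" for i :: 'a and k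
    proof (induction k)
      case (Suc k)
      have "Poly_Mapping.single i (Suc k) = Poly_Mapping.single i 1 + Poly_Mapping.single i k"
        by (simp flip: single_add)
      then have "Poly_Mapping.single (Poly_Mapping.single i (Suc k)) 1 =
          rvar i * Poly_Mapping.single (Poly_Mapping.single i k) 1"
        by (simp only: rvar_def mult_single mult_1)
      then show ?case using Suc by simp
    qed simp
    then have "Poly_Mapping.single (m + Poly_Mapping.single i k) 1 = Poly_Mapping.single m 1 * rvar i ^ k"
      by (metis mult_1 mult_single)
    then show ?case using polys_in.mult[OF add power_in[OF polys_in.var[OF UNIV_I]]] by metis
  qed
  from polys_in.mult[OF polys_in.const this, of c m] have "Poly_Mapping.single m c \<in> polys_in UNIV"
    by (simp add: mult_single)
  then show ?case using add by (intro polys_in.add)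
qed

lemma polys_in_empty: "p \<in> polys_in {} \<Longrightarrow> \<exists>r. p = rconst r"
proof (induction rule: polys_in.induct)
  case (add p q)
  then show ?case by (auto simp flip: single_add)
next
  case (mult p q)
  then show ?case by (auto simp: mult_single)
qed auto

lemma polys_in_insert:
  "p \<in> polys_in (insert x V) \<Longrightarrow> \<exists>P\<in>poly_over (polys_in V). p = poly P (rvar x)"
proof (induction rule: polys_in.induct)
  case (const r)
  interpret subring_set "polys_in V" by (rule polys_in_subring)
  show ?case using poly_over_monom[OF polys_in.const[of r], of 0]
    by (intro bexI[of _ "[:rconst r:]"]) (auto simp: monom_0)
next
  case (var i)
  interpret subring_set "polys_in V" by (rule polys_in_subring)
  show ?case
  proof (cases "i \<in> V")
    case True
    then show ?thesis using poly_over_monom[OF polys_in.var[OF True], of 0]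
      by (intro bexI[of _ "[:rvar i:]"]) (auto simp: monom_0)
  next
    case False
    then show ?thesis using poly_over_monom[OF one_in, of 1] var
      by (intro bexI[of _ "monom 1 1"]) (auto simp: poly_monom)
  qed
next
  case (add p q)
  interpret subring_set "poly_over (polys_in V)"
    by (intro subring_set.poly_over_subring polys_in_subring)
  from add obtain P Q where "P \<in> poly_over (polys_in V)" "Q \<in> poly_over (polys_in V)"
    "p = poly P (rvar x)" "q = poly Q (rvar x)" by blast
  then show ?case by (intro bexI[of _ "P + Q"]) (auto intro: add_in)
next
  case (mult p q)
  interpret subring_set "poly_over (polys_in V)"
    by (intro subring_set.poly_over_subring polys_in_subring)
  from mult obtain P Q where "P \<in> poly_over (polys_in V)" "Q \<in> poly_over (polys_in V)"
    "p = poly P (rvar x)" "q = poly Q (rvar x)" by blast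
  then show ?case by (intro bexI[of _ "P * Q"]) (auto intro: mult_in)
qed

lemma poly_in_polys_in_insert:
  assumes "P \<in> poly_over (polys_in V)"
  shows "poly P (rvar x) \<in> polys_in (insert x V)"
proof -
  interpret subring_set "polys_in (insert x V)" by (rule polys_in_subring)
  have "p \<in> polys_in (insert x V)" if "p \<in> polys_in V" for p
    using that by (induction rule: polys_in.induct) (auto intro: polys_in.intros)
  then show ?thesis using assms unfolding poly_altdef poly_over_def
    by (intro sum_in mult_in power_in polys_in.var) auto
qed

lemma noetherian_polys_in: "finite V \<Longrightarrow> noetherian_set (polys_in V)"
proof (induction V rule: finite_induct)
  case empty
  show ?case
    unfolding noetherian_set_def
  proof (intro allI impI)
    fix J :: "'a rpoly set" assume J: "ideal_of (polys_in {}) J"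
    show "\<exists>G. finite G \<and> G \<subseteq> J \<and> (\<forall>K. ideal_of (polys_in {}) K \<longrightarrow> G \<subseteq> K \<longrightarrow> J \<subseteq> K)"
    proof (cases "J \<subseteq> {0}")
      case True
      then show ?thesis by (intro exI[of _ "{}"]) (auto simp: ideal_of_def)
    next
      case False
      then obtain p where p: "p \<in> J" "p \<noteq> 0" by blast
      then obtain r where r: "p = rconst r" using J polys_in_empty unfolding ideal_of_def by blast
      then have "r \<noteq> 0" using p by auto
      have "J \<subseteq> K" if K: "ideal_of (polys_in {}) K" "p \<in> K" for K
      proof
        fix q assume "q \<in> J"
        then obtain s where s: "q = rconst s" using J polys_in_empty unfolding ideal_of_def by blast
        then have "q = rconst (s / r) * p" using \<open>r \<noteq> 0\<close> by (simp add: r mult_single)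
        then show "q \<in> K" using K polys_in.const unfolding ideal_of_def by blast
      qed
      then show ?thesis using p by (intro exI[of _ "{p}"]) auto
    qed
  qed
next
  case (insert x V)
  have N: "noetherian_set (poly_over (polys_in V))"
    using Hilbert_basis[OF polys_in_subring insert(3)] .
  define pull where "pull J = {P\<in>poly_over (polys_in V). poly P (rvar x) \<in> J}" for J
  have pull: "ideal_of (poly_over (polys_in V)) (pull J)" if "ideal_of (polys_in (insert x V)) J" for J
  proof -
    interpret subring_set "poly_over (polys_in V)"
      by (intro subring_set.poly_over_subring polys_in_subring)
    show ?thesis using that poly_in_polys_in_insert[of _ V x] unfolding ideal_of_def pull_def
      by (auto intro: add_in mult_in zero_in)
  qed
  show ?case
    unfolding noetherian_set_def
  proof (intro allI impI)
    fix J assume J: "ideal_of (polys_in (insert x V)) J"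
    obtain G where G: "finite G" "G \<subseteq> pull J" "\<And>K. ideal_of (poly_over (polys_in V)) K \<Longrightarrow> G \<subseteq> K \<Longrightarrow> pull J \<subseteq> K"
      using noetherian_setD[OF N pull[OF J]] by blast
    have "J \<subseteq> K" if K: "ideal_of (polys_in (insert x V)) K" "(\<lambda>P. poly P (rvar x)) ` G \<subseteq> K" for K
    proof
      fix q assume q: "q \<in> J"
      have "G \<subseteq> pull K" using K(2) G(2) unfolding pull_def by blast
      then have PK: "pull J \<subseteq> pull K" using G(3) pull[OF K(1)] by blast
      have "q \<in> polys_in (insert x V)" using q J unfolding ideal_of_def by blast
      from polys_in_insert[OF this] obtain P where "P \<in> poly_over (polys_in V)" "q = poly P (rvar x)"
        by blast
      then show "q \<in> K" using PK q unfolding pull_def by blast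
    qed
    then show "\<exists>G. finite G \<and> G \<subseteq> J \<and> (\<forall>K. ideal_of (polys_in (insert x V)) K \<longrightarrow> G \<subseteq> K \<longrightarrow> J \<subseteq> K)"
      using G(1,2) unfolding pull_def by (intro exI[of _ "(\<lambda>P. poly P (rvar x)) ` G"]) auto
  qed
qed

lemma real_variety_finite_subset:
  fixes I :: "'n::finite rpoly set"
  assumes "is_ideal I"
  shows "\<exists>G. finite G \<and> G \<subseteq> I \<and> real_variety G = real_variety I"
proof -
  have U: "polys_in UNIV = (UNIV :: 'n rpoly set)" using polys_in_UNIV by blast
  have "noetherian_set (UNIV :: 'n rpoly set)"
    using noetherian_polys_in[of "UNIV :: 'n set"] unfolding U by simp
  moreover have "ideal_of UNIV I" using assms unfolding is_ideal_def ideal_of_def by auto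
  ultimately have "\<exists>G. finite G \<and> G \<subseteq> I \<and> (\<forall>K. ideal_of UNIV K \<longrightarrow> G \<subseteq> K \<longrightarrow> I \<subseteq> K)"
    by (rule noetherian_setD)
  then obtain G where G: "finite G" "G \<subseteq> I" "\<And>K. ideal_of UNIV K \<Longrightarrow> G \<subseteq> K \<Longrightarrow> I \<subseteq> K"
    by blast
  have "x \<in> real_variety I" if "x \<in> real_variety G" for x
  proof -
    have "ideal_of UNIV {f. eval f x = 0}" by (auto simp: ideal_of_def eval_add eval_mult)
    then show ?thesis using G(3) that unfolding real_variety_def by blast
  qed
  then show ?thesis using G unfolding real_variety_def by blast
qed

section \<open>The Artin--Lang theorem\<close>

lemma hom_rconst_same_sign:
  fixes \<phi> :: "'n rpoly \<Rightarrow> 'f::linordered_field"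
  assumes "typed_ring_hom \<phi>"
  shows "same_sign (\<phi> (rconst r)) r"
proof -
  interpret typed_ring_hom \<phi> by fact
  have pos: "0 < \<phi> (rconst r)" if "0 < r" for r
  proof -
    have "rconst r = (rconst (sqrt r) :: 'n rpoly) * rconst (sqrt r)" using that by (simp add: mult_single)
    then have "\<phi> (rconst r) = \<phi> (rconst (sqrt r)) * \<phi> (rconst (sqrt r))" by (metis hom_mult)
    moreover have "rconst r * rconst (1 / r) = (1 :: 'n rpoly)" using that by (simp add: mult_single)
    then have "\<phi> (rconst r) * \<phi> (rconst (1 / r)) = 1" by (metis hom_mult hom_1)
    ultimately show ?thesis by (metis mult_zero_left not_square_less_zero linorder_neqE zero_neq_one)
  qed
  have "\<phi> (rconst r) = - \<phi> (rconst (- r))" by (simp add: single_uminus hom_uminus)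
  then show ?thesis using pos[of r] pos[of "- r"] unfolding same_sign_def
    by (cases r "0::real" rule: linorder_cases) auto
qed

lemma eval_polys_in_cong:
  fixes x y :: "real ^ 'n::finite"
  assumes "p \<in> polys_in V" "\<And>i. i \<in> V \<Longrightarrow> x $ i = y $ i"
  shows "eval p x = eval p y"
  using assms(1) by (induction rule: polys_in.induct) (auto simp: assms(2) eval_add eval_mult)

lemma Artin_Lang_polys_in:
  fixes \<phi> :: "'n::finite rpoly \<Rightarrow> 'f::rcf"
  assumes \<phi>: "typed_ring_hom \<phi>"
  shows "finite V \<Longrightarrow> finite S \<Longrightarrow> S \<subseteq> polys_in V \<Longrightarrow> \<exists>a. \<forall>q\<in>S. same_sign (\<phi> q) (eval q a)"
proof (induction V arbitrary: S rule: finite_induct)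
  case empty
  then show ?case using hom_rconst_same_sign[OF \<phi>] polys_in_empty by (metis eval_rconst subsetD)
next
  case (insert x V)
  interpret \<phi>: typed_ring_hom \<phi> by fact
  interpret subring_set "polys_in V" by (rule polys_in_subring)
  have "\<exists>P. P \<in> poly_over (polys_in V) \<and> q = poly P (rvar x)" if "q \<in> S" for q
  proof -
    have "q \<in> polys_in (insert x V)" using that insert.prems(2) by blast
    from polys_in_insert[OF this] show ?thesis by blast
  qed
  then have "\<forall>q\<in>S. \<exists>P. P \<in> poly_over (polys_in V) \<and> q = poly P (rvar x)" by blast
  from bchoice[OF this] obtain P where
    "\<forall>q\<in>S. P q \<in> poly_over (polys_in V) \<and> q = poly (P q) (rvar x)" by (elim exE)
  then have P: "P q \<in> poly_over (polys_in V)" "q = poly (P q) (rvar x)" if "q \<in> S" for q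
    using that by blast+
  have "finite (P ` S)" "P ` S \<subseteq> poly_over (polys_in V)" using P insert.prems by auto
  from rem_closure[OF this] obtain T where T: "finite T" "P ` S \<subseteq> T" "T \<subseteq> poly_over (polys_in V)"
    "trunc_deriv_closed T" "rem_closed_above 0 T" by blast
  have "finite (lead_coeff ` T)" "lead_coeff ` T \<subseteq> polys_in V" using T lead_coeff_in by auto
  from insert.IH[OF this] obtain a where a: "\<forall>q\<in>lead_coeff ` T. same_sign (\<phi> q) (eval q a)" by blast
  from closed_family_sign_transfer[OF \<phi> eval_hom T(1,4,5), of a "\<phi> (rvar x)"] a
  obtain s where s: "\<forall>p\<in>T. same_sign (poly (map_poly \<phi> p) (\<phi> (rvar x))) (poly (map_poly (\<lambda>q. eval q a) p) s)"
    by auto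
  define b where "b = (\<chi> j. if j = x then s else a $ j)"
  have "same_sign (\<phi> q) (eval q b)" if q: "q \<in> S" for q
  proof -
    interpret e: typed_ring_hom "\<lambda>q. eval q b" by (rule eval_hom)
    have "map_poly (\<lambda>q. eval q b) (P q) = map_poly (\<lambda>q. eval q a) (P q)"
    proof (rule poly_eqI)
      fix i
      have "coeff (P q) i \<in> polys_in V" using P(1)[OF q] unfolding poly_over_def by blast
      moreover have "b $ j = a $ j" if "j \<in> V" for j using that insert.hyps by (auto simp: b_def)
      ultimately have "eval (coeff (P q) i) b = eval (coeff (P q) i) a" by (rule eval_polys_in_cong)
      then show "coeff (map_poly (\<lambda>q. eval q b) (P q)) i = coeff (map_poly (\<lambda>q. eval q a) (P q)) i"
        by (simp add: coeff_map_poly)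
    qed
    then have "eval q b = poly (map_poly (\<lambda>q. eval q a) (P q)) s"
      using e.hom_poly[of "P q" "rvar x"] P(2)[OF q] by (simp add: b_def)
    moreover have "\<phi> q = poly (map_poly \<phi> (P q)) (\<phi> (rvar x))"
      using \<phi>.hom_poly[of "P q" "rvar x"] P(2)[OF q] by simp
    ultimately show ?thesis using s T(2) q by auto
  qed
  then show ?case by blast
qed

theorem Artin_Lang:
  fixes \<phi> :: "'n::finite rpoly \<Rightarrow> 'f::rcf"
  assumes "typed_ring_hom \<phi>" "finite S"
  shows "\<exists>a. \<forall>q\<in>S. same_sign (\<phi> q) (eval q a)"
  using Artin_Lang_polys_in[OF assms(1) _ assms(2), of UNIV] polys_in_UNIV by auto

section \<open>Real closure\<close>

definition cone_span :: "'a::ring_1 set \<Rightarrow> 'a set" where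
  "cone_span N = {x - y | x y. x \<in> N \<and> y \<in> N}"

definition field_cone :: "'a::linordered_field alg_closure set \<Rightarrow> bool" where
  "field_cone N \<longleftrightarrow> (\<forall>x\<in>N. \<forall>y\<in>N. x + y \<in> N \<and> x * y \<in> N) \<and> - 1 \<notin> N \<and> (\<forall>a\<ge>0. to_ac a \<in> N) \<and>
     (\<forall>x\<in>cone_span N. x * x \<in> N \<and> inverse x \<in> cone_span N)"

lemma cone_spanI: "x \<in> N \<Longrightarrow> y \<in> N \<Longrightarrow> x - y \<in> cone_span N"
  unfolding cone_span_def by blast

lemma cone_spanE:
  assumes "z \<in> cone_span N"
  obtains x y where "x \<in> N" "y \<in> N" "z = x - y"
  using assms unfolding cone_span_def by blast

lemma field_coneD:
  assumes "field_cone N"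
  shows "x \<in> N \<Longrightarrow> y \<in> N \<Longrightarrow> x + y \<in> N" "x \<in> N \<Longrightarrow> y \<in> N \<Longrightarrow> x * y \<in> N" "- 1 \<notin> N"
    "0 \<le> a \<Longrightarrow> to_ac a \<in> N" "x \<in> cone_span N \<Longrightarrow> x * x \<in> N" "x \<in> cone_span N \<Longrightarrow> inverse x \<in> cone_span N"
    "0 \<in> N" "1 \<in> N"
  using assms unfolding field_cone_def
  by (blast | metis to_ac_0 to_ac_1 order_refl zero_le_one)+

lemma cone_subset_span: "field_cone N \<Longrightarrow> N \<subseteq> cone_span N"
  using cone_spanI[of _ N 0] field_coneD(7) by fastforce

lemma cone_span_closed:
  assumes N: "field_cone N" and "x \<in> cone_span N" "y \<in> cone_span N"
  shows "x + y \<in> cone_span N" "x - y \<in> cone_span N" "x * y \<in> cone_span N" "- x \<in> cone_span N"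
proof -
  obtain a b c d where *: "a \<in> N" "b \<in> N" "c \<in> N" "d \<in> N" "x = a - b" "y = c - d"
    using assms by (metis cone_spanE)
  have "(a + c) - (b + d) \<in> cone_span N" "(a + d) - (b + c) \<in> cone_span N"
    "(a * c + b * d) - (a * d + b * c) \<in> cone_span N" "b - a \<in> cone_span N"
    using * field_coneD(1,2)[OF N] by (simp_all add: cone_spanI)
  moreover have "(a + c) - (b + d) = x + y" "(a + d) - (b + c) = x - y"
    "(a * c + b * d) - (a * d + b * c) = x * y" "b - a = - x"
    by (simp_all add: * algebra_simps)
  ultimately show "x + y \<in> cone_span N" "x - y \<in> cone_span N" "x * y \<in> cone_span N" "- x \<in> cone_span N"
    by simp_all
qed

lemma field_cone_base: "field_cone (to_ac ` {a :: 'a::linordered_field. 0 \<le> a})"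
proof -
  have span: "cone_span (to_ac ` {a :: 'a. 0 \<le> a}) = range to_ac"
  proof
    show "cone_span (to_ac ` {a :: 'a. 0 \<le> a}) \<subseteq> range to_ac"
      by (auto elim!: cone_spanE simp flip: to_ac_diff)
    show "range to_ac \<subseteq> cone_span (to_ac ` {a :: 'a. 0 \<le> a})"
    proof clarify
      fix a :: 'a
      have "to_ac (max a 0) - to_ac (max (- a) 0) \<in> cone_span (to_ac ` {a :: 'a. 0 \<le> a})"
        by (intro cone_spanI) auto
      moreover have "max a 0 - max (- a) 0 = a" by (auto simp: max_def)
      ultimately show "to_ac a \<in> cone_span (to_ac ` {a :: 'a. 0 \<le> a})" by (metis to_ac_diff)
    qed
  qed
  have "- 1 \<noteq> to_ac a" if "0 \<le> a" for a :: 'a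
  proof
    assume "- 1 = to_ac a"
    then have "to_ac (- 1) = to_ac a" by simp
    then show False using that unfolding to_ac_eq_iff by simp
  qed
  moreover have "x * x \<in> to_ac ` {a. 0 \<le> a}" "inverse x \<in> range to_ac" if x: "x \<in> range to_ac" for x :: "'a alg_closure"
  proof -
    obtain a where a: "x = to_ac a" using x by blast
    have "to_ac (a * a) \<in> to_ac ` {a. 0 \<le> a}" by (intro imageI) simp
    then show "x * x \<in> to_ac ` {a. 0 \<le> a}" by (simp add: a)
    show "inverse x \<in> range to_ac" unfolding a by (metis rangeI to_ac_inverse)
  qed
  ultimately show ?thesis unfolding field_cone_def span
    by (auto simp flip: to_ac_add to_ac_mult)
qed

lemma field_cone_Union:
  assumes chain: "subset.chain (Collect field_cone) C" and "C \<noteq> {}"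
  shows "field_cone (\<Union>C)"
proof -
  have C: "field_cone N" if "N \<in> C" for N using chain that unfolding subset.chain_def by blast
  have two: "\<exists>N\<in>C. x \<in> N \<and> y \<in> N" if xy: "x \<in> \<Union>C" "y \<in> \<Union>C" for x y
  proof -
    obtain M N where MN: "M \<in> C" "N \<in> C" "x \<in> M" "y \<in> N" using xy by blast
    then have "M \<subseteq> N \<or> N \<subseteq> M" using chain unfolding subset.chain_def by blast
    then show ?thesis using MN by blast
  qed
  have span: "\<exists>N\<in>C. x \<in> cone_span N" if "x \<in> cone_span (\<Union>C)" for x
    using that two by (elim cone_spanE) (metis cone_spanI)
  have mono: "cone_span N \<subseteq> cone_span (\<Union>C)" if "N \<in> C" for N
    using that unfolding cone_span_def by blast
  obtain N0 where "N0 \<in> C" using \<open>C \<noteq> {}\<close> by blast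
  show ?thesis
    unfolding field_cone_def
  proof (intro conjI ballI allI impI)
    fix x y assume "x \<in> \<Union>C" "y \<in> \<Union>C"
    then obtain N where N: "N \<in> C" "x \<in> N" "y \<in> N" using two by blast
    then show "x + y \<in> \<Union>C" "x * y \<in> \<Union>C" using field_coneD(1,2)[OF C[OF N(1)]] by blast+
  next
    show "- 1 \<notin> \<Union>C" using field_coneD(3)[OF C] by blast
  next
    fix a :: 'a assume "0 \<le> a"
    then show "to_ac a \<in> \<Union>C" using field_coneD(4)[OF C[OF \<open>N0 \<in> C\<close>]] \<open>N0 \<in> C\<close> by blast
  next
    fix x assume "x \<in> cone_span (\<Union>C)"
    then obtain N where N: "N \<in> C" "x \<in> cone_span N" using span by blast
    then show "x * x \<in> \<Union>C" "inverse x \<in> cone_span (\<Union>C)"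
      using field_coneD(5,6)[OF C[OF N(1)] N(2)] mono by blast+
  qed
qed

definition max_cone :: "'a::linordered_field alg_closure set" where
  "max_cone = (SOME N. field_cone N \<and> (\<forall>M. field_cone M \<longrightarrow> N \<subseteq> M \<longrightarrow> M = N))"

lemma max_cone: "field_cone (max_cone :: 'a::linordered_field alg_closure set) \<and>
  (\<forall>M :: 'a alg_closure set. field_cone M \<longrightarrow> max_cone \<subseteq> M \<longrightarrow> M = max_cone)"
proof -
  have "\<exists>N\<in>(Collect field_cone :: 'a alg_closure set set). \<forall>M\<in>Collect field_cone. N \<subseteq> M \<longrightarrow> M = N"
  proof (rule subset_Zorn)
    fix C :: "'a alg_closure set set" assume C: "subset.chain (Collect field_cone) C"
    show "\<exists>U\<in>Collect field_cone. \<forall>Y\<in>C. Y \<subseteq> U"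
    proof (cases "C = {}")
      case True
      then show ?thesis using field_cone_base by blast
    next
      case False
      then show ?thesis using field_cone_Union[OF C] by blast
    qed
  qed
  then have "\<exists>N :: 'a alg_closure set. field_cone N \<and> (\<forall>M. field_cone M \<longrightarrow> N \<subseteq> M \<longrightarrow> M = N)"
    by simp
  then show ?thesis unfolding max_cone_def by (rule someI_ex)
qed

lemmas max_field_cone = max_cone[THEN conjunct1]
lemmas max_coneD = field_coneD[OF max_field_cone]
lemmas max_cone_maximal = max_cone[THEN conjunct2, rule_format]

lemma max_cone_antisym:
  assumes "x \<in> max_cone" "- x \<in> max_cone"
  shows "x = 0"
proof (rule ccontr)
  assume "x \<noteq> 0"
  have "inverse x \<in> cone_span max_cone"
    using assms(1) cone_subset_span[OF max_field_cone] max_coneD(6) by blast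
  then have "(x * - x) * (inverse x * inverse x) \<in> max_cone" using assms max_coneD(2,5) by blast
  moreover have "(x * - x) * (inverse x * inverse x) = - 1" using \<open>x \<noteq> 0\<close> by (simp add: field_simps)
  ultimately show False using max_coneD(3) by metis
qed

lemma max_cone_total:
  assumes x: "x \<in> cone_span max_cone"
  shows "x \<in> max_cone \<or> - x \<in> max_cone"
proof (cases "\<exists>a b. a \<in> max_cone \<and> b \<in> max_cone \<and> - 1 = a + x * b")
  case True
  then obtain a b where ab: "a \<in> max_cone" "b \<in> max_cone" "- 1 = a + x * b"
    by (elim exE conjE)
  have "b \<noteq> 0" using ab max_coneD(3) by auto
  have "inverse b \<in> cone_span max_cone" using ab(2) cone_subset_span[OF max_field_cone] max_coneD(6) by blast
  then have "(1 + a) * b * (inverse b * inverse b) \<in> max_cone"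
    using max_coneD(2)[OF max_coneD(2)[OF max_coneD(1)[OF max_coneD(8) ab(1)] ab(2)] max_coneD(5)] by blast
  moreover have "a = - 1 - x * b" using ab(3) by (simp add: eq_diff_eq)
  then have "1 + a = - x * b" by simp
  then have "(1 + a) * b * (inverse b * inverse b) = - x" using \<open>b \<noteq> 0\<close> by (simp add: field_simps)
  ultimately show ?thesis by simp
next
  case False
  define M where "M = {a + x * b | a b. a \<in> max_cone \<and> b \<in> max_cone}"
  have MI: "a + x * b \<in> M" if "a \<in> max_cone" "b \<in> max_cone" for a b using that unfolding M_def by blast
  have "max_cone \<subseteq> M" using MI[OF _ max_coneD(7)] by fastforce
  have "M \<subseteq> cone_span max_cone"
  proof
    fix y assume "y \<in> M"
    then obtain a b where *: "a \<in> max_cone" "b \<in> max_cone" "y = a + x * b" unfolding M_def by blast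
    then have "a \<in> cone_span max_cone" "b \<in> cone_span max_cone"
      using cone_subset_span[OF max_field_cone] by blast+
    then show "y \<in> cone_span max_cone" unfolding *(3)
      by (intro cone_span_closed(1,3)[OF max_field_cone] x)
  qed
  then have span: "cone_span M \<subseteq> cone_span max_cone"
    by (auto elim!: cone_spanE intro!: cone_span_closed(2)[OF max_field_cone])
  have span': "cone_span max_cone \<subseteq> cone_span M"
    using \<open>max_cone \<subseteq> M\<close> unfolding cone_span_def by blast
  have "field_cone M"
    unfolding field_cone_def
  proof (intro conjI ballI allI impI)
    fix y z assume "y \<in> M" "z \<in> M"
    then obtain a b c d where *: "a \<in> max_cone" "b \<in> max_cone" "c \<in> max_cone" "d \<in> max_cone"
      "y = a + x * b" "z = c + x * d" unfolding M_def by blast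
    have "a * c + (x * x) * (b * d) \<in> max_cone" "a * d + b * c \<in> max_cone"
      using max_coneD(1)[OF max_coneD(2)[OF *(1,3)] max_coneD(2)[OF max_coneD(5)[OF x] max_coneD(2)[OF *(2,4)]]]
        max_coneD(1)[OF max_coneD(2)[OF *(1,4)] max_coneD(2)[OF *(2,3)]] by auto
    then have "(a + c) + x * (b + d) \<in> M" "(a * c + (x * x) * (b * d)) + x * (a * d + b * c) \<in> M"
      using MI max_coneD(1)[OF *(1,3)] max_coneD(1)[OF *(2,4)] by blast+
    then show "y + z \<in> M" "y * z \<in> M" by (simp_all add: * algebra_simps)
  next
    show "- 1 \<notin> M" using False unfolding M_def by blast
  next
    fix a :: 'a assume "0 \<le> a"
    then show "to_ac a \<in> M" using max_coneD(4) \<open>max_cone \<subseteq> M\<close> by blast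
  next
    fix y assume "y \<in> cone_span M"
    then show "y * y \<in> M" "inverse y \<in> cone_span M"
      using span span' max_coneD(5,6) \<open>max_cone \<subseteq> M\<close> by blast+
  qed
  then have "M = max_cone" using max_cone_maximal \<open>max_cone \<subseteq> M\<close> by blast
  then show ?thesis using MI[OF max_coneD(7,8)] by simp
qed

typedef (overloaded) 'a rclosure = "cone_span (max_cone :: 'a::linordered_field alg_closure set)"
  using cone_subset_span[OF max_field_cone] max_coneD(7) by blast

setup_lifting type_definition_rclosure

instantiation rclosure :: (linordered_field) field
begin

lift_definition zero_rclosure :: "'a rclosure" is 0
  using cone_subset_span[OF max_field_cone] max_coneD(7) by blast
lift_definition one_rclosure :: "'a rclosure" is 1
  using cone_subset_span[OF max_field_cone] max_coneD(8) by blast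
lift_definition plus_rclosure :: "'a rclosure \<Rightarrow> 'a rclosure \<Rightarrow> 'a rclosure" is "(+)"
  by (rule cone_span_closed[OF max_field_cone])
lift_definition minus_rclosure :: "'a rclosure \<Rightarrow> 'a rclosure \<Rightarrow> 'a rclosure" is "(-)"
  by (rule cone_span_closed[OF max_field_cone])
lift_definition times_rclosure :: "'a rclosure \<Rightarrow> 'a rclosure \<Rightarrow> 'a rclosure" is "(*)"
  by (rule cone_span_closed[OF max_field_cone])
lift_definition uminus_rclosure :: "'a rclosure \<Rightarrow> 'a rclosure" is uminus
  by (rule cone_span_closed[OF max_field_cone])
lift_definition inverse_rclosure :: "'a rclosure \<Rightarrow> 'a rclosure" is inverse
  by (rule max_coneD(6))
lift_definition divide_rclosure :: "'a rclosure \<Rightarrow> 'a rclosure \<Rightarrow> 'a rclosure" is "(/)"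
  unfolding divide_inverse by (intro cone_span_closed[OF max_field_cone] max_coneD(6))

instance
  by standard (transfer, simp add: algebra_simps divide_inverse)+

end

instantiation rclosure :: (linordered_field) linordered_field
begin

lift_definition less_eq_rclosure :: "'a rclosure \<Rightarrow> 'a rclosure \<Rightarrow> bool" is "\<lambda>x y. y - x \<in> max_cone" .
definition less_rclosure :: "'a rclosure \<Rightarrow> 'a rclosure \<Rightarrow> bool" where
  "less_rclosure x y \<longleftrightarrow> x \<le> y \<and> \<not> y \<le> x"
definition abs_rclosure :: "'a rclosure \<Rightarrow> 'a rclosure" where
  "abs_rclosure x = (if x < 0 then - x else x)"
definition sgn_rclosure :: "'a rclosure \<Rightarrow> 'a rclosure" where
  "sgn_rclosure x = (if x = 0 then 0 else if 0 < x then 1 else - 1)"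

instance
proof
  fix x y z :: "'a rclosure"
  show "x < y \<longleftrightarrow> x \<le> y \<and> \<not> y \<le> x" by (rule less_rclosure_def)
  show "x \<le> x" by transfer (simp add: max_coneD(7))
  show "x \<le> y \<Longrightarrow> y \<le> z \<Longrightarrow> x \<le> z"
    by transfer (use max_coneD(1) in fastforce)
  show antisym: "x \<le> y \<Longrightarrow> y \<le> x \<Longrightarrow> x = y" for x y :: "'a rclosure"
    by transfer (use max_cone_antisym in fastforce)
  show "x \<le> y \<or> y \<le> x"
    by transfer (metis max_cone_total cone_span_closed(2)[OF max_field_cone] minus_diff_eq)
  show "x \<le> y \<Longrightarrow> z + x \<le> z + y" by transfer simp
  show "\<bar>x\<bar> = (if x < 0 then - x else x)" by (rule abs_rclosure_def)
  show "sgn x = (if x = 0 then 0 else if 0 < x then 1 else - 1)" by (rule sgn_rclosure_def)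
  have le: "x \<le> y \<Longrightarrow> 0 \<le> z \<Longrightarrow> z * x \<le> z * y"
    by transfer (metis max_coneD(2) diff_zero right_diff_distrib)
  show "x < y \<Longrightarrow> 0 < z \<Longrightarrow> z * x < z * y"
    unfolding less_rclosure_def using le antisym by (metis mult_left_cancel order.refl)
qed

end

lemma Rep_rclosure_hom: "typed_ring_hom Rep_rclosure"
  by standard (simp_all add: plus_rclosure.rep_eq times_rclosure.rep_eq one_rclosure.rep_eq)

lemma Rep_rclosure_nonneg_iff: "Rep_rclosure x \<in> max_cone \<longleftrightarrow> 0 \<le> x"
  by transfer simp

lift_definition to_rc :: "'a::linordered_field \<Rightarrow> 'a rclosure" is to_ac
proof -
  fix a :: 'a
  show "to_ac a \<in> cone_span max_cone"
  proof (cases "0 \<le> a")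
    case True
    then show ?thesis using max_coneD(4) cone_subset_span[OF max_field_cone] by blast
  next
    case False
    then have "to_ac (- a) \<in> max_cone" using max_coneD(4)[of "- a"] by simp
    then show ?thesis using cone_spanI[OF max_coneD(7)] by fastforce
  qed
qed

lemma to_rc_hom: "typed_ring_hom to_rc"
proof
  show "to_rc (x + y) = to_rc x + to_rc y" for x y :: 'a by transfer simp
  show "to_rc (x * y) = to_rc x * to_rc y" for x y :: 'a by transfer simp
  show "to_rc (1 :: 'a) = 1" by transfer simp
qed

lemma to_rc_nonneg: "0 \<le> a \<Longrightarrow> 0 \<le> to_rc a"
  by transfer (simp add: max_coneD(4))

lemma (in typed_ring_hom) map_poly_hom_1: "map_poly h 1 = 1"
  by (simp add: map_poly_1)

lemma inj_Rep_rclosure: "Rep_rclosure x = 0 \<longleftrightarrow> x = 0"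
  by transfer simp

text \<open>A sign-changing polynomial of minimal degree without the expected root is irreducible.
  Adjoining a root would then extend \<^const>\<open>max_cone\<close>.\<close>

locale rootless_minimal =
  fixes p :: "'a::linordered_field rclosure poly" and a b :: "'a rclosure" and c :: "'a alg_closure"
  assumes ab: "a < b" and sgn_p: "poly p a < 0" "0 < poly p b"
    and no_root: "\<And>x. a < x \<Longrightarrow> x < b \<Longrightarrow> poly p x \<noteq> 0"
    and IVT_below: "\<And>(q :: 'a rclosure poly) a b. degree q < degree p \<Longrightarrow> a < b \<Longrightarrow> poly q a < 0 \<Longrightarrow> 0 < poly q b \<Longrightarrow>
      \<exists>x. a < x \<and> x < b \<and> poly q x = 0"
    and root_c: "poly (map_poly Rep_rclosure p) c = 0"
begin

definition at_c :: "'a rclosure poly \<Rightarrow> 'a alg_closure" where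
  "at_c q = poly (map_poly Rep_rclosure q) c"

lemma at_c_simps:
  "at_c (q + r) = at_c q + at_c r" "at_c (q * r) = at_c q * at_c r" "at_c (q - r) = at_c q - at_c r"
  "at_c 0 = 0" "at_c 1 = 1" "at_c [:s:] = Rep_rclosure s" "at_c (smult s q) = Rep_rclosure s * at_c q"
  "at_c (- q) = - at_c q"
proof -
  interpret typed_ring_hom "Rep_rclosure :: 'a rclosure \<Rightarrow> _" by (rule Rep_rclosure_hom)
  show *: "at_c (q + r) = at_c q + at_c r" "at_c (q * r) = at_c q * at_c r" "at_c (q - r) = at_c q - at_c r"
    "at_c 0 = 0" "at_c 1 = 1" "at_c [:s:] = Rep_rclosure s" "at_c (smult s q) = Rep_rclosure s * at_c q" for q r s
    by (simp_all add: at_c_def map_poly_hom_add map_poly_hom_mult map_poly_hom_diff map_poly_hom_smult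
        map_poly_hom_1 map_poly_pCons)
  show "at_c (- q) = - at_c q" using *(3)[of 0 q] *(4) by simp
qed

lemma degree_p: "0 < degree p"
proof (rule ccontr)
  assume "\<not> 0 < degree p"
  then obtain k where "p = [:k:]" by (metis degree_eq_zeroE neq0_conv)
  then show False using sgn_p by simp
qed

lemma degree_ge:
  assumes "at_c g = 0" "g \<noteq> 0"
  shows "degree p \<le> degree g"
proof -
  obtain g where g: "at_c g = 0" "g \<noteq> 0" and min: "\<And>h. at_c h = 0 \<Longrightarrow> h \<noteq> 0 \<Longrightarrow> degree g \<le> degree h"
    using ex_has_least_nat[of "\<lambda>h. at_c h = 0 \<and> h \<noteq> 0" _ degree] assms by blast
  have "degree p \<le> degree g"
  proof (rule ccontr)
    assume lt: "\<not> degree p \<le> degree g"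
    have "at_c (p mod g) = 0"
      using root_c at_c_simps(1,2)[of "p div g * g" "p mod g"] at_c_simps(2)[of "p div g" g] g
      by (simp add: at_c_def[of p])
    then have "p mod g = 0" using min[of "p mod g"] degree_mod_less[of g p] g(2) by force
    then have pg: "p = g * (p div g)" by (metis mod_0_imp_dvd dvd_mult_div_cancel)
    define q where "q = p div g"
    have "degree g \<noteq> 0"
    proof
      assume "degree g = 0"
      then obtain k where "g = [:k:]" by (metis degree_eq_zeroE)
      then show False using g at_c_simps(6)[of k] inj_Rep_rclosure[of k] by simp
    qed
    moreover have "degree p = degree g + degree q"
    proof -
      have "q \<noteq> 0" using pg degree_p unfolding q_def[symmetric] by auto
      from degree_mult_eq[OF g(2) this] show ?thesis using pg unfolding q_def[symmetric] by simp
    qed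
    ultimately have dq: "degree q < degree p" by simp
    have dg: "degree g < degree p" using lt by simp
    have pq: "poly p x = poly g x * poly q x" for x using pg unfolding q_def[symmetric] by (metis poly_mult)
    have sc: "\<exists>x. a < x \<and> x < b \<and> poly r x = 0" if "degree r < degree p" "poly r a * poly r b < 0" for r
      using that IVT_below[OF that(1) ab] IVT_below[of "- r", OF _ ab] by (auto simp: mult_less_0_iff)
    have "(poly g a * poly g b) * (poly q a * poly q b) < 0"
      using mult_neg_pos[OF sgn_p] by (simp add: pq mult_ac)
    then have "poly g a * poly g b < 0 \<or> poly q a * poly q b < 0" by (auto simp: mult_less_0_iff)
    then show False using sc[OF dg] sc[OF dq] no_root pq by fastforce
  qed
  then show ?thesis using min assms order_trans by blast
qed

lemma dvd_if_root: "at_c g = 0 \<Longrightarrow> p dvd g"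
proof -
  assume g: "at_c g = 0"
  have p0: "p \<noteq> 0" using degree_p by auto
  have "at_c (g mod p) = 0"
    using root_c at_c_simps(1)[of "g div p * p" "g mod p"] at_c_simps(2)[of "g div p" p] g
    by (simp add: at_c_def[of p])
  then have "g mod p = 0" using degree_ge[of "g mod p"] degree_mod_less[OF p0, of g] by force
  then show ?thesis by (rule mod_0_imp_dvd)
qed

lemma at_c_mod: "at_c (g mod p) = at_c g"
  using at_c_simps(1)[of "g div p * p" "g mod p"] at_c_simps(2)[of "g div p" p] root_c
  by (simp add: at_c_def[of p])

lemma degree_mod_p: "degree (g mod p) < degree p"
proof -
  have "p \<noteq> 0" using degree_p by auto
  then show ?thesis using degree_mod_less[OF \<open>p \<noteq> 0\<close>, of g] degree_p by force
qed

lemma at_c_inverse: "\<exists>h. inverse (at_c g) = at_c h"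
proof -
  have "at_c g \<noteq> 0 \<Longrightarrow> degree g < degree p \<Longrightarrow> \<exists>h. at_c g * at_c h = 1" for g
  proof (induction "degree g" arbitrary: g rule: less_induct)
    case less
    have g0: "g \<noteq> 0" using less.prems at_c_simps(4) by auto
    show ?case
    proof (cases "degree g = 0")
      case True
      then obtain k where k: "g = [:k:]" by (metis degree_eq_zeroE)
      then have "k \<noteq> 0" using g0 by auto
      then have "Rep_rclosure k * Rep_rclosure (inverse k) = 1"
        by (metis one_rclosure.rep_eq right_inverse times_rclosure.rep_eq)
      then show ?thesis using k at_c_simps(6) by metis
    next
      case False
      define q r where "q = p div g" and "r = p mod g"
      have "p = q * g + r" by (simp add: q_def r_def)
      then have "at_c q * at_c g + at_c r = 0" using root_c at_c_simps(1,2) at_c_def by metis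
      then have r: "at_c r = at_c g * at_c (- q)" by (simp add: at_c_simps eq_neg_iff_add_eq_0 add.commute mult.commute)
      have dr: "degree r < degree g" using degree_mod_less[OF g0, of p] False by (auto simp: r_def)
      have "at_c q \<noteq> 0"
      proof
        assume q: "at_c q = 0"
        have "q \<noteq> 0" using less.prems(2) g0 by (auto simp: q_def div_poly_eq_0_iff)
        then have "degree p \<le> degree q" using degree_ge q by blast
        moreover have "degree p = degree q + degree g"
        proof -
          have "degree (q * g) = degree q + degree g" using \<open>q \<noteq> 0\<close> g0 by (rule degree_mult_eq)
          then show ?thesis using \<open>p = q * g + r\<close> dr degree_add_eq_left[of r "q * g"] by simp
        qed
        ultimately show False using False by simp
      qed
      then have "at_c r \<noteq> 0" using r less.prems(1) by (simp add: at_c_simps)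
      from less.hyps[OF dr this] dr less.prems(2) obtain h where "at_c r * at_c h = 1" by auto
      then have "at_c g * at_c (- q * h) = 1" unfolding r at_c_simps by (simp add: mult_ac)
      then show ?thesis by blast
    qed
  qed
  from this[of "g mod p"] have "at_c g \<noteq> 0 \<Longrightarrow> \<exists>h. at_c g * at_c h = 1"
    using at_c_mod degree_mod_p by simp
  then show ?thesis using at_c_simps(4) by (metis inverse_unique inverse_zero)
qed

inductive_set sq_sums :: "'a rclosure poly set" where
  zero: "0 \<in> sq_sums"
| step: "q \<in> sq_sums \<Longrightarrow> 0 \<le> n \<Longrightarrow> degree g < degree p \<Longrightarrow> q + smult n (g * g) \<in> sq_sums"

lemma sq_sums_nonneg: "q \<in> sq_sums \<Longrightarrow> 0 \<le> poly q x"
  by (induction rule: sq_sums.induct) auto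

lemma sq_sums_degree: "q \<in> sq_sums \<Longrightarrow> degree q \<le> 2 * (degree p - 1)"
proof (induction rule: sq_sums.induct)
  case (step q n g)
  have "degree (smult n (g * g)) \<le> degree (g * g)" by (rule degree_smult_le)
  also have "\<dots> \<le> degree g + degree g" by (rule degree_mult_le)
  also have "\<dots> \<le> 2 * (degree p - 1)" using step by simp
  finally show ?case using step by (intro degree_add_le)
qed auto

definition ext_cone :: "'a alg_closure set" where
  "ext_cone = at_c ` sq_sums"

lemma ext_cone_zero: "0 \<in> ext_cone"
  unfolding ext_cone_def using sq_sums.zero at_c_simps(4) by (metis imageI)

lemma ext_cone_step:
  assumes "x \<in> ext_cone" "0 \<le> n"
  shows "x + Rep_rclosure n * (at_c g * at_c g) \<in> ext_cone"
proof -
  obtain q where q: "q \<in> sq_sums" "x = at_c q" using assms(1) unfolding ext_cone_def by blast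
  have "at_c (q + smult n ((g mod p) * (g mod p))) = x + Rep_rclosure n * (at_c g * at_c g)"
    by (simp add: at_c_simps at_c_mod q)
  then show ?thesis using sq_sums.step[OF q(1) assms(2) degree_mod_p[of g]] unfolding ext_cone_def
    by (metis imageI)
qed

lemma ext_cone_induct [consumes 1, case_names zero step]:
  assumes "x \<in> ext_cone" "P 0"
    "\<And>x n g. x \<in> ext_cone \<Longrightarrow> P x \<Longrightarrow> 0 \<le> n \<Longrightarrow> P (x + Rep_rclosure n * (at_c g * at_c g))"
  shows "P x"
proof -
  have "P (at_c q)" if "q \<in> sq_sums" for q
    using that
  proof (induction rule: sq_sums.induct)
    case zero
    then show ?case using assms(2) by (simp add: at_c_simps)
  next
    case (step q n g)
    then show ?case using assms(3)[of "at_c q" n g] by (simp add: at_c_simps ext_cone_def)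
  qed
  then show ?thesis using assms(1) unfolding ext_cone_def by blast
qed

lemma ext_cone_add:
  assumes x: "x \<in> ext_cone" and y: "y \<in> ext_cone"
  shows "x + y \<in> ext_cone"
  using y
proof (induction rule: ext_cone_induct)
  case (step y n g)
  then show ?case using ext_cone_step[of "x + y" n g] by (simp add: add.assoc)
qed (simp add: x)

lemma ext_cone_square: "0 \<le> n \<Longrightarrow> Rep_rclosure n * (at_c g * at_c g) \<in> ext_cone"
  using ext_cone_step[OF ext_cone_zero, of n g] by simp

lemma ext_cone_mult:
  assumes x: "x \<in> ext_cone" and y: "y \<in> ext_cone"
  shows "x * y \<in> ext_cone"
  using y
proof (induction rule: ext_cone_induct)
  case zero
  then show ?case by (simp add: ext_cone_zero)
next
  case (step y n g)
  have "x * (Rep_rclosure n * (at_c g * at_c g)) \<in> ext_cone" using x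
  proof (induction rule: ext_cone_induct)
    case zero
    then show ?case by (simp add: ext_cone_zero)
  next
    case (step x m h)
    have "Rep_rclosure (m * n) * (at_c (h * g) * at_c (h * g)) \<in> ext_cone"
      using \<open>0 \<le> m\<close> \<open>0 \<le> n\<close> by (intro ext_cone_square) simp
    moreover have "Rep_rclosure (m * n) * (at_c (h * g) * at_c (h * g)) =
        Rep_rclosure m * (at_c h * at_c h) * (Rep_rclosure n * (at_c g * at_c g))"
      by (simp add: at_c_simps times_rclosure.rep_eq mult_ac)
    ultimately show ?case using ext_cone_add[OF step.IH] by (simp only: distrib_right)
  qed
  then show ?case using ext_cone_add step by (simp add: distrib_left)
qed

lemma ext_cone_span: "cone_span ext_cone = range at_c"
proof
  show "cone_span ext_cone \<subseteq> range at_c"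
    by (auto simp: ext_cone_def elim!: cone_spanE simp flip: at_c_simps)
  show "range at_c \<subseteq> cone_span ext_cone"
  proof clarify
    fix g
    have "Rep_rclosure (1/4) * (at_c (g + 1) * at_c (g + 1)) - Rep_rclosure (1/4) * (at_c (g - 1) * at_c (g - 1))
        \<in> cone_span ext_cone"
      by (intro cone_spanI ext_cone_square) simp_all
    moreover have "smult (1/4) ((g + 1) * (g + 1)) - smult (1/4) ((g - 1) * (g - 1)) = smult (1/4) (smult 4 g)"
      unfolding smult_diff_right[symmetric] by (simp add: algebra_simps numeral_poly)
    then have "smult (1/4) ((g + 1) * (g + 1)) - smult (1/4) ((g - 1) * (g - 1)) = g" by simp
    ultimately show "at_c g \<in> cone_span ext_cone" by (metis at_c_simps(2,3,7))
  qed
qed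

lemma minus_one_notin_ext_cone: "- 1 \<notin> ext_cone"
proof
  assume "- 1 \<in> ext_cone"
  then obtain q where q: "q \<in> sq_sums" "at_c q = - 1" unfolding ext_cone_def by force
  define G where "G = 1 + q"
  have pos: "1 \<le> poly G x" for x using sq_sums_nonneg[OF q(1), of x] by (simp add: G_def)
  have "at_c G = 0" by (simp add: G_def at_c_simps q)
  then obtain h where h: "G = p * h" using dvd_if_root by blast
  have "h \<noteq> 0" using h pos[of a] by auto
  moreover have "p \<noteq> 0" using degree_p by auto
  ultimately have "degree G = degree p + degree h" unfolding h by (intro degree_mult_eq)
  moreover have "degree G \<le> 2 * (degree p - 1)"
    unfolding G_def by (intro degree_add_le sq_sums_degree[OF q(1)]) simp
  ultimately have dh: "degree h < degree p" using degree_p by simp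
  have "0 < poly p a * poly h a" "0 < poly p b * poly h b"
    using pos[of a] pos[of b] unfolding h poly_mult by linarith+
  then have "poly h a < 0" "0 < poly h b" using sgn_p by (auto simp: zero_less_mult_iff)
  from IVT_below[OF dh ab this] obtain x where "poly h x = 0" by blast
  then show False using pos[of x] unfolding h by simp
qed

lemma contradiction: False
proof -
  have "max_cone \<subseteq> ext_cone"
  proof
    fix x assume x: "x \<in> (max_cone :: 'a alg_closure set)"
    then have "x \<in> cone_span max_cone" using cone_subset_span[OF max_field_cone] by blast
    then obtain n where n: "x = Rep_rclosure n" by (metis Rep_rclosure_cases)
    then have "0 \<le> n" using x Rep_rclosure_nonneg_iff by blast
    from ext_cone_square[OF this, of 1] show "x \<in> ext_cone" by (simp add: n at_c_simps)
  qed
  moreover have "field_cone ext_cone"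
    unfolding field_cone_def
  proof (intro conjI ballI allI impI)
    show "x + y \<in> ext_cone" "x * y \<in> ext_cone" if "x \<in> ext_cone" "y \<in> ext_cone" for x y
      using that ext_cone_add ext_cone_mult by blast+
    show "- 1 \<notin> ext_cone" by (rule minus_one_notin_ext_cone)
    show "to_ac s \<in> ext_cone" if "0 \<le> s" for s
      using max_coneD(4)[OF that] calculation by blast
    fix x assume "x \<in> cone_span ext_cone"
    then obtain g where g: "x = at_c g" unfolding ext_cone_span by blast
    have "Rep_rclosure 1 * (at_c g * at_c g) \<in> ext_cone" by (rule ext_cone_square) simp
    then show "x * x \<in> ext_cone" by (simp add: g one_rclosure.rep_eq)
    show "inverse x \<in> cone_span ext_cone" unfolding ext_cone_span g using at_c_inverse[of g] by auto
  qed
  ultimately have "ext_cone = max_cone" using max_cone_maximal by blast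
  then have "at_c [:0, 1:] \<in> cone_span max_cone" using ext_cone_span by (metis rangeI)
  then obtain r where r: "at_c [:0, 1:] = Rep_rclosure r" by (metis Rep_rclosure_cases)
  have "[:- r, 1:] = [:0, 1:] - [:r:]" by simp
  then have "at_c [:- r, 1:] = 0" using at_c_simps(3,6) r by (metis diff_self)
  then have "p dvd [:- r, 1:]" by (rule dvd_if_root)
  then obtain h where h: "[:- r, 1:] = p * h" by blast
  then have hn0: "h \<noteq> 0" "p \<noteq> 0" by auto
  have "degree p + degree h = 1" using degree_mult_eq[OF hn0(2,1)] unfolding h[symmetric] by simp
  then have "degree h = 0" using degree_p by simp
  then obtain k where k: "h = [:k:]" by (metis degree_eq_zeroE)
  have *: "x - r = poly p x * k" for x using arg_cong[OF h, of "\<lambda>q. poly q x"] by (simp add: k)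
  have "k \<noteq> 0" using k hn0 by auto
  then have "poly p r = 0" using *[of r] by simp
  moreover have "k > 0"
  proof (rule ccontr)
    assume "\<not> 0 < k"
    then have "0 < poly p a * k" "poly p b * k < 0" using \<open>k \<noteq> 0\<close> sgn_p
      by (auto intro: mult_neg_neg mult_pos_neg)
    then show False using *[of a] *[of b] ab by simp
  qed
  then have "a - r < 0" "0 < b - r" unfolding * using sgn_p by (auto intro: mult_neg_pos)
  ultimately show False using no_root[of r] by simp
qed

end

lemma rclosure_poly_IVT:
  fixes p :: "'a::linordered_field rclosure poly"
  shows "a < b \<Longrightarrow> poly p a < 0 \<Longrightarrow> 0 < poly p b \<Longrightarrow> \<exists>x. a < x \<and> x < b \<and> poly p x = 0"
proof (induction "degree p" arbitrary: p a b rule: less_induct)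
  case less
  show ?case
  proof (rule ccontr)
    assume no: "\<not> ?case"
    have "\<exists>c. poly (map_poly Rep_rclosure p) c = 0"
    proof (rule alg_closed_imp_poly_has_root)
      have "degree (map_poly Rep_rclosure p) = degree p"
        by (rule degree_map_poly) (simp add: inj_Rep_rclosure)
      moreover have "degree p \<noteq> 0"
      proof
        assume "degree p = 0"
        then obtain k where "p = [:k:]" by (metis degree_eq_zeroE)
        then show False using less.prems by simp
      qed
      ultimately show "0 < degree (map_poly Rep_rclosure p)" by simp
    qed
    then obtain c where "poly (map_poly Rep_rclosure p) c = 0" by blast
    then interpret rootless_minimal p a b c
      using less no by unfold_locales blast+
    show False by (rule contradiction)
  qed
qed

instance rclosure :: (linordered_field) rcf
  by standard (unfold sum_eq_poly_sum_monom, rule rclosure_poly_IVT)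

section \<open>Prime cones\<close>

definition preordering :: "'a::comm_ring_1 set \<Rightarrow> bool" where
  "preordering T \<longleftrightarrow> (\<forall>x\<in>T. \<forall>y\<in>T. x + y \<in> T \<and> x * y \<in> T) \<and> (\<forall>x. x * x \<in> T)"

definition prime_cone :: "'a::comm_ring_1 set \<Rightarrow> bool" where
  "prime_cone P \<longleftrightarrow> (\<forall>x\<in>P. \<forall>y\<in>P. x + y \<in> P \<and> x * y \<in> P) \<and> (\<forall>x. x \<in> P \<or> - x \<in> P) \<and> - 1 \<notin> P \<and>
     (\<forall>x y. x * y \<in> P \<longrightarrow> - (x * y) \<in> P \<longrightarrow> x \<in> P \<and> - x \<in> P \<or> y \<in> P \<and> - y \<in> P)"

lemma preorderingD:
  assumes "preordering T"
  shows "x \<in> T \<Longrightarrow> y \<in> T \<Longrightarrow> x + y \<in> T" "x \<in> T \<Longrightarrow> y \<in> T \<Longrightarrow> x * y \<in> T" "x * x \<in> T" "0 \<in> T" "1 \<in> T"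
  using assms unfolding preordering_def by (blast | metis mult_zero_left mult_1)+

lemma preordering_adjoin:
  assumes T: "preordering T"
  shows "preordering {a + x * b | a b. a \<in> T \<and> b \<in> T}"
  unfolding preordering_def
proof (intro conjI ballI allI)
  let ?M = "{a + x * b | a b. a \<in> T \<and> b \<in> T}"
  have MI: "a + x * b \<in> ?M" if "a \<in> T" "b \<in> T" for a b using that by blast
  fix y z assume "y \<in> ?M" "z \<in> ?M"
  then obtain a b c d where *: "a \<in> T" "b \<in> T" "c \<in> T" "d \<in> T" "y = a + x * b" "z = c + x * d" by blast
  have "a + c \<in> T" "b + d \<in> T" "a * c + (x * x) * (b * d) \<in> T" "a * d + b * c \<in> T"
    using preorderingD(1)[OF T *(1,3)] preorderingD(1)[OF T *(2,4)]
      preorderingD(1)[OF T preorderingD(2)[OF T *(1,3)] preorderingD(2)[OF T preorderingD(3)[OF T, of x] preorderingD(2)[OF T *(2,4)]]]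
      preorderingD(1)[OF T preorderingD(2)[OF T *(1,4)] preorderingD(2)[OF T *(2,3)]] by auto
  then have "(a + c) + x * (b + d) \<in> ?M" "(a * c + (x * x) * (b * d)) + x * (a * d + b * c) \<in> ?M"
    using MI by blast+
  moreover have "y + z = (a + c) + x * (b + d)" "y * z = (a * c + (x * x) * (b * d)) + x * (a * d + b * c)"
    by (simp_all add: * algebra_simps)
  ultimately show "y + z \<in> ?M" "y * z \<in> ?M" by simp_all
next
  fix y
  have "y * y + x * 0 \<in> {a + x * b | a b. a \<in> T \<and> b \<in> T}" using preorderingD(3,4)[OF T] by blast
  then show "y * y \<in> {a + x * b | a b. a \<in> T \<and> b \<in> T}" by simp
qed

lemma preordering_Union:
  assumes chain: "subset.chain {T. preordering T \<and> - 1 \<notin> T} C" and "C \<noteq> {}"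
  shows "preordering (\<Union>C) \<and> - 1 \<notin> \<Union>C"
proof -
  have C: "preordering T" "- 1 \<notin> T" if "T \<in> C" for T using chain that unfolding subset.chain_def by blast+
  obtain T0 where "T0 \<in> C" using \<open>C \<noteq> {}\<close> by blast
  have "x + y \<in> \<Union>C \<and> x * y \<in> \<Union>C" if xy: "x \<in> \<Union>C" "y \<in> \<Union>C" for x y
  proof -
    obtain M N where MN: "M \<in> C" "N \<in> C" "x \<in> M" "y \<in> N" using xy by blast
    then have "M \<subseteq> N \<or> N \<subseteq> M" using chain unfolding subset.chain_def by blast
    then obtain N where N: "N \<in> C" "x \<in> N" "y \<in> N" using MN by blast
    then show ?thesis using preorderingD(1,2)[OF C(1)[OF N(1)]] by blast
  qed
  moreover have "x * x \<in> \<Union>C" for x using preorderingD(3)[OF C(1)[OF \<open>T0 \<in> C\<close>]] \<open>T0 \<in> C\<close> by blast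
  ultimately show ?thesis using C(2) unfolding preordering_def by blast
qed

lemma minus_one_eq_addD: "- 1 = a + y \<Longrightarrow> 1 + a = - (y :: 'a::comm_ring_1)"
proof -
  assume "- 1 = a + y"
  then have "a = - 1 - y" by (simp add: eq_diff_eq)
  then show ?thesis by simp
qed

lemma preordering_subset_prime_cone:
  assumes T: "preordering T" "- 1 \<notin> T"
  shows "\<exists>P. T \<subseteq> P \<and> prime_cone P"
proof -
  define A where "A = {P. preordering P \<and> - 1 \<notin> P \<and> T \<subseteq> P}"
  have "\<exists>P\<in>A. \<forall>M\<in>A. P \<subseteq> M \<longrightarrow> M = P"
  proof (rule subset_Zorn)
    fix C assume C: "subset.chain A C"
    show "\<exists>U\<in>A. \<forall>N\<in>C. N \<subseteq> U"
    proof (cases "C = {}")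
      case True
      then show ?thesis using T unfolding A_def by blast
    next
      case False
      have "subset.chain {T. preordering T \<and> - 1 \<notin> T} C"
        using C unfolding subset.chain_def A_def by blast
      from preordering_Union[OF this False] have "\<Union>C \<in> A"
        using False C unfolding A_def subset.chain_def by blast
      then show ?thesis by blast
    qed
  qed
  then obtain P where PA: "P \<in> A" and maxA: "\<forall>M\<in>A. P \<subseteq> M \<longrightarrow> M = P" by (elim bexE)
  then have P: "preordering P" "- 1 \<notin> P" "T \<subseteq> P" unfolding A_def by blast+
  have max: "M = P" if "preordering M" "- 1 \<notin> M" "P \<subseteq> M" for M
    using maxA that P(3) unfolding A_def by blast
  note Pd = preorderingD[OF P(1)]
  have ext: "\<exists>a\<in>P. \<exists>b\<in>P. - 1 = a + x * b" if x: "x \<notin> P" for x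
  proof (rule ccontr)
    assume "\<not> (\<exists>a\<in>P. \<exists>b\<in>P. - 1 = a + x * b)"
    then have no: "- 1 \<notin> {a + x * b | a b. a \<in> P \<and> b \<in> P}" by blast
    have "a \<in> {a + x * b | a b. a \<in> P \<and> b \<in> P}" if "a \<in> P" for a
    proof -
      have "a + x * 0 \<in> {a + x * b | a b. a \<in> P \<and> b \<in> P}" using that Pd(4) by blast
      then show ?thesis by simp
    qed
    then have "{a + x * b | a b. a \<in> P \<and> b \<in> P} = P"
      by (intro max preordering_adjoin P(1) no) blast
    moreover have "0 + x * 1 \<in> {a + x * b | a b. a \<in> P \<and> b \<in> P}" using Pd(4,5) by blast
    ultimately show False using x by simp
  qed
  have comb: "a + c + a * c + z \<in> P" if "a \<in> P" "c \<in> P" "z \<in> P" for a c z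
    using that by (intro Pd(1,2))
  have total: "x \<in> P \<or> - x \<in> P" for x
  proof (rule ccontr)
    assume "\<not> (x \<in> P \<or> - x \<in> P)"
    then obtain a b c d where *: "a \<in> P" "b \<in> P" "c \<in> P" "d \<in> P" "- 1 = a + x * b" "- 1 = c + - x * d"
      using ext[of x] ext[of "- x"] by blast
    have e: "1 + a = - (x * b)" "1 + c = x * d"
      using minus_one_eq_addD[OF *(5)] minus_one_eq_addD[OF *(6)] by simp_all
    have "(1 + a) * (1 + c) = - ((x * x) * (b * d))" unfolding e by (simp add: algebra_simps)
    then have "a + c + a * c + (x * x) * (b * d) = - 1" by (simp add: algebra_simps eq_neg_iff_add_eq_0)
    moreover have "a + c + a * c + (x * x) * (b * d) \<in> P"
      using * by (intro comb) (auto intro: Pd(2) Pd(3))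
    ultimately show False using P(2) by simp
  qed
  have prime: "x \<in> P \<and> - x \<in> P \<or> y \<in> P \<and> - y \<in> P" if xy: "x * y \<in> P" "- (x * y) \<in> P" for x y
  proof (rule ccontr)
    assume H: "\<not> (x \<in> P \<and> - x \<in> P \<or> y \<in> P \<and> - y \<in> P)"
    obtain x' where x': "x' = x \<or> x' = - x" "x' \<notin> P" using H by blast
    obtain y' where y': "y' = y \<or> y' = - y" "y' \<notin> P" using H by blast
    have xy': "- (x' * y') \<in> P" using x'(1) y'(1) xy by auto
    obtain a b where ab: "a \<in> P" "b \<in> P" "- 1 = a + x' * b" using ext[OF x'(2)] by blast
    obtain c d where cd: "c \<in> P" "d \<in> P" "- 1 = c + y' * d" using ext[OF y'(2)] by blast
    have e: "1 + a = - (x' * b)" "1 + c = - (y' * d)"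
      using minus_one_eq_addD[OF ab(3)] minus_one_eq_addD[OF cd(3)] by simp_all
    have "(1 + a) * (1 + c) = - (- (x' * y') * (b * d))" unfolding e by (simp add: algebra_simps)
    then have "a + c + a * c + - (x' * y') * (b * d) = - 1" by (simp add: algebra_simps eq_neg_iff_add_eq_0)
    moreover have "a + c + a * c + - (x' * y') * (b * d) \<in> P"
      using ab cd xy' by (intro comb Pd(2)) auto
    ultimately show False using P(2) by simp
  qed
  have "prime_cone P" unfolding prime_cone_def using Pd(1,2) P(2) total prime by blast
  then show ?thesis using P(3) by blast
qed

lemma prime_coneD:
  assumes "prime_cone P"
  shows "x \<in> P \<Longrightarrow> y \<in> P \<Longrightarrow> x + y \<in> P" "x \<in> P \<Longrightarrow> y \<in> P \<Longrightarrow> x * y \<in> P" "x \<in> P \<or> - x \<in> P" "- 1 \<notin> P"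
    "x * y \<in> P \<Longrightarrow> - (x * y) \<in> P \<Longrightarrow> x \<in> P \<and> - x \<in> P \<or> y \<in> P \<and> - y \<in> P"
  using assms unfolding prime_cone_def by blast+

lemma prime_cone_01:
  assumes "prime_cone P"
  shows "0 \<in> P" "1 \<in> P"
  using prime_coneD(3)[OF assms, of 0] prime_coneD(3)[OF assms, of 1] prime_coneD(4)[OF assms] by auto

lemma prime_cone_support_mult:
  assumes P: "prime_cone P" and x: "x \<in> P" "- x \<in> P"
  shows "r * x \<in> P" "- (r * x) \<in> P"
  using prime_coneD(3)[OF P, of r] prime_coneD(2)[OF P] x
  by (metis minus_mult_commute minus_mult_left minus_mult_right minus_minus)+

definition realizes :: "'n::finite rpoly set \<Rightarrow> 'n rpoly set \<Rightarrow> real ^ 'n \<Rightarrow> bool" where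
  "realizes P S a \<longleftrightarrow> (\<forall>q\<in>S. (0 < eval q a \<longleftrightarrow> - q \<notin> P) \<and> (eval q a < 0 \<longleftrightarrow> q \<notin> P))"

text \<open>Types cannot depend on a cone that is fixed in a proof. So one closed term picks a prime
  cone that violates the finite realization property if there is any such cone at all, and the
  residue ring is formed for that single cone.\<close>
definition test_cone :: "'n::finite rpoly set" where
  "test_cone = (SOME P. prime_cone P \<and>
     ((\<exists>(Q :: 'n rpoly set) S. prime_cone Q \<and> finite S \<and> \<not> (\<exists>a. realizes Q S a)) \<longrightarrow>
      (\<exists>S. finite S \<and> \<not> (\<exists>a. realizes P S a))))"

lemma test_cone:
  "prime_cone (test_cone :: 'n::finite rpoly set) \<and>
     ((\<exists>(Q :: 'n rpoly set) S. prime_cone Q \<and> finite S \<and> \<not> (\<exists>a. realizes Q S a)) \<longrightarrow>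
       (\<exists>S. finite S \<and> \<not> (\<exists>a. realizes (test_cone :: 'n rpoly set) S a)))"
proof -
  have "prime_cone {p :: 'n rpoly. 0 \<le> eval p 0}"
    using eval_hom[THEN typed_ring_hom.hom_uminus, of _ "0 :: real ^ 'n"]
    unfolding prime_cone_def by (auto simp: eval_add eval_mult)
  then have "\<exists>P :: 'n rpoly set. prime_cone P \<and>
     ((\<exists>Q S. prime_cone (Q :: 'n rpoly set) \<and> finite S \<and> \<not> (\<exists>a. realizes Q S a)) \<longrightarrow>
      (\<exists>S. finite S \<and> \<not> (\<exists>a. realizes P S a)))"
    by blast
  then show ?thesis unfolding test_cone_def by (rule someI_ex)
qed

lemmas prime_test_cone = test_cone[THEN conjunct1]
lemmas test_coneD = prime_coneD[OF prime_test_cone]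

definition cone_equiv :: "'n::finite rpoly \<Rightarrow> 'n rpoly \<Rightarrow> bool" where
  "cone_equiv p q \<longleftrightarrow> p - q \<in> test_cone \<and> q - p \<in> test_cone"

lemma cone_equiv_equivp: "equivp (cone_equiv :: 'n::finite rpoly \<Rightarrow> _)"
proof (rule equivpI)
  show "reflp (cone_equiv :: 'n rpoly \<Rightarrow> _)" by (auto simp: reflp_def cone_equiv_def prime_cone_01[OF prime_test_cone])
  show "symp (cone_equiv :: 'n rpoly \<Rightarrow> _)" by (auto simp: symp_def cone_equiv_def)
  show "transp (cone_equiv :: 'n rpoly \<Rightarrow> _)"
  proof (rule transpI)
    fix p q r :: "'n rpoly" assume "cone_equiv p q" "cone_equiv q r"
    then show "cone_equiv p r"
      using test_coneD(1)[of "p - q" "q - r"] test_coneD(1)[of "r - q" "q - p"] by (simp add: cone_equiv_def)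
  qed
qed

quotient_type (overloaded) 'n residue = "('n::finite \<Rightarrow>\<^sub>0 nat) \<Rightarrow>\<^sub>0 real" / cone_equiv
  by (rule cone_equiv_equivp)

lemma cone_equiv_add: "cone_equiv p p' \<Longrightarrow> cone_equiv q q' \<Longrightarrow> cone_equiv (p + q) (p' + q')"
  using test_coneD(1)[of "p - p'" "q - q'"] test_coneD(1)[of "p' - p" "q' - q"]
  by (simp add: cone_equiv_def algebra_simps)

lemma cone_equiv_uminus: "cone_equiv p p' \<Longrightarrow> cone_equiv (- p) (- p')"
  by (simp add: cone_equiv_def)

lemma cone_equiv_mult_left: "cone_equiv p p' \<Longrightarrow> cone_equiv (r * p) (r * p')"
  using prime_cone_support_mult[OF prime_test_cone, of "p - p'" r]
  by (simp add: cone_equiv_def right_diff_distrib)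

lemma cone_equiv_mult: "cone_equiv p p' \<Longrightarrow> cone_equiv q q' \<Longrightarrow> cone_equiv (p * q) (p' * q')"
  using cone_equiv_mult_left[of q q' p] cone_equiv_mult_left[of p p' q'] equivp_transp[OF cone_equiv_equivp]
  by (metis mult.commute)

lemma cone_equiv_mem: "cone_equiv p p' \<Longrightarrow> p \<in> test_cone \<Longrightarrow> p' \<in> test_cone"
  using test_coneD(1)[of "p' - p" p] by (simp add: cone_equiv_def)

instantiation residue :: (finite) idom
begin

lift_definition zero_residue :: "'a residue" is 0 .
lift_definition one_residue :: "'a residue" is 1 .
lift_definition plus_residue :: "'a residue \<Rightarrow> 'a residue \<Rightarrow> 'a residue" is "(+)" by (rule cone_equiv_add)
lift_definition times_residue :: "'a residue \<Rightarrow> 'a residue \<Rightarrow> 'a residue" is "(*)" by (rule cone_equiv_mult)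
lift_definition uminus_residue :: "'a residue \<Rightarrow> 'a residue" is uminus by (rule cone_equiv_uminus)
lift_definition minus_residue :: "'a residue \<Rightarrow> 'a residue \<Rightarrow> 'a residue" is "(-)"
  using cone_equiv_add cone_equiv_uminus by (metis diff_conv_add_uminus)

instance
proof
  have refl: "cone_equiv p p" for p :: "'a rpoly" by (rule equivp_reflp[OF cone_equiv_equivp])
  fix x y z :: "'a residue"
  show "x + y + z = x + (y + z)" "x + y = y + x" "0 + x = x" "- x + x = 0" "x - y = x + - y"
    "x * y * z = x * (y * z)" "x * y = y * x" "1 * x = x" "(x + y) * z = x * z + y * z"
    "0 * x = 0" "x * 0 = 0" "x * (y + z) = x * y + x * z"
    by (transfer, simp add: algebra_simps refl)+
  show "(0 :: 'a residue) \<noteq> 1" by transfer (use test_coneD(4) in \<open>auto simp: cone_equiv_def\<close>)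
  show "x \<noteq> 0 \<Longrightarrow> y \<noteq> 0 \<Longrightarrow> x * y \<noteq> 0"
    by transfer (use test_coneD(5) in \<open>auto simp: cone_equiv_def\<close>)
qed

end

instantiation residue :: (finite) linordered_idom
begin

lift_definition less_eq_residue :: "'a residue \<Rightarrow> 'a residue \<Rightarrow> bool" is "\<lambda>x y. y - x \<in> test_cone"
proof -
  fix p p' q q' :: "'a rpoly" assume "cone_equiv p p'" "cone_equiv q q'"
  then have "cone_equiv (q - p) (q' - p')" "cone_equiv (q' - p') (q - p)"
    using cone_equiv_add[of q q' "- p" "- p'"] cone_equiv_uminus[of p p'] equivp_symp[OF cone_equiv_equivp] by auto
  then show "(q - p \<in> test_cone) = (q' - p' \<in> test_cone)" using cone_equiv_mem by blast
qed

definition less_residue :: "'a residue \<Rightarrow> 'a residue \<Rightarrow> bool" where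
  "less_residue x y \<longleftrightarrow> x \<le> y \<and> \<not> y \<le> x"
definition absolute_value_residue_def: "abs (x :: 'a residue) = (if x < 0 then - x else x)"
definition sgn_residue_def: "sgn (x :: 'a residue) = (if x = 0 then 0 else if 0 < x then 1 else - 1)"

instance
proof
  fix x y z :: "'a residue"
  show "x < y \<longleftrightarrow> x \<le> y \<and> \<not> y \<le> x" by (rule less_residue_def)
  show "x \<le> x" by transfer (simp add: prime_cone_01[OF prime_test_cone])
  show "x \<le> y \<Longrightarrow> y \<le> z \<Longrightarrow> x \<le> z"
    by transfer (use test_coneD(1) in fastforce)
  show antisym: "x \<le> y \<Longrightarrow> y \<le> x \<Longrightarrow> x = y" for x y :: "'a residue"
    by transfer (simp add: cone_equiv_def)
  show "x \<le> y \<or> y \<le> x"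
    by transfer (metis test_coneD(3) minus_diff_eq)
  show "x \<le> y \<Longrightarrow> z + x \<le> z + y" by transfer simp
  show "\<bar>x\<bar> = (if x < 0 then - x else x)" by (rule absolute_value_residue_def)
  show "sgn x = (if x = 0 then 0 else if 0 < x then 1 else - 1)" by (rule sgn_residue_def)
  have le: "x \<le> y \<Longrightarrow> 0 \<le> z \<Longrightarrow> z * x \<le> z * y"
    by transfer (metis test_coneD(2) diff_zero right_diff_distrib)
  show "x < y \<Longrightarrow> 0 < z \<Longrightarrow> z * x < z * y"
    unfolding less_residue_def using le antisym by (metis mult_left_cancel order.refl)
qed

end

lemma abs_residue_hom: "typed_ring_hom abs_residue"
  by standard (simp_all add: plus_residue.abs_eq times_residue.abs_eq one_residue_def)

lemma abs_residue_nonneg_iff: "0 \<le> abs_residue p \<longleftrightarrow> p \<in> test_cone"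
  by (simp add: zero_residue_def less_eq_residue.abs_eq)

lemma to_rc_pos_iff: "0 < to_rc x \<longleftrightarrow> 0 < x"
proof -
  interpret typed_ring_hom to_rc by (rule to_rc_hom)
  have z: "to_rc x = 0 \<longleftrightarrow> x = 0" for x :: 'a by transfer simp
  show ?thesis
  proof (cases x "0 :: 'a" rule: linorder_cases)
    case less
    then have "0 \<le> to_rc (- x)" by (intro to_rc_nonneg) simp
    then show ?thesis using less by (simp add: hom_uminus)
  next
    case greater
    then show ?thesis using to_rc_nonneg[of x] z[of x] by (simp add: less_le)
  qed simp
qed

lemma test_cone_realized:
  assumes "finite S"
  shows "\<exists>a. realizes (test_cone :: 'n::finite rpoly set) S a"
proof -
  define h :: "'n rpoly \<Rightarrow> 'n residue fract rclosure" where "h p = to_rc (Fract (abs_residue p) 1)" for p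
  interpret t: typed_ring_hom "abs_residue :: 'n rpoly \<Rightarrow> _" by (rule abs_residue_hom)
  interpret r: typed_ring_hom "to_rc :: 'n residue fract \<Rightarrow> _" by (rule to_rc_hom)
  have "typed_ring_hom h"
    by standard (simp_all add: h_def t.hom_add t.hom_mult flip: r.hom_add r.hom_mult One_fract_def)
  from Artin_Lang[OF this assms] obtain a where a: "\<forall>q\<in>S. same_sign (h q) (eval q a)" by blast
  have pos: "0 < h q \<longleftrightarrow> - q \<notin> test_cone" for q
  proof -
    have "0 < h q \<longleftrightarrow> \<not> 0 \<le> abs_residue (- q)"
      by (simp add: h_def to_rc_pos_iff zero_less_Fract_iff t.hom_uminus not_le)
    then show ?thesis by (simp add: abs_residue_nonneg_iff)
  qed
  have "h (- q) = - h q" for q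
    using typed_ring_hom.hom_uminus[OF \<open>typed_ring_hom h\<close>] .
  then have neg: "h q < 0 \<longleftrightarrow> q \<notin> test_cone" for q using pos[of "- q"] by simp
  show ?thesis using a pos neg unfolding realizes_def same_sign_def by blast
qed

theorem prime_cone_realized:
  assumes "prime_cone (P :: 'n::finite rpoly set)" "finite S"
  shows "\<exists>a. realizes P S a"
  using assms test_cone[where 'n='n] test_cone_realized by blast

section \<open>Sums of squares modulo an ideal\<close>

definition sos_mod :: "'n::finite rpoly set \<Rightarrow> 'n rpoly set" where
  "sos_mod I = {h. \<exists>gs. h - (\<Sum>g\<leftarrow>gs. g ^ 2) \<in> I}"

lemma is_idealD:
  assumes "is_ideal I"
  shows "0 \<in> I" "a \<in> I \<Longrightarrow> b \<in> I \<Longrightarrow> a + b \<in> I" "a \<in> I \<Longrightarrow> r * a \<in> I" "a \<in> I \<Longrightarrow> - a \<in> I"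
proof -
  show *: "0 \<in> I" "a \<in> I \<Longrightarrow> b \<in> I \<Longrightarrow> a + b \<in> I" "a \<in> I \<Longrightarrow> r * a \<in> I" for a b r
    using assms unfolding is_ideal_def by blast+
  show "a \<in> I \<Longrightarrow> - a \<in> I" using *(3)[of a "- 1"] by simp
qed

lemma sum_list_squares_mult:
  fixes gs hs :: "'a::comm_ring_1 list"
  shows "(\<Sum>g\<leftarrow>gs. g ^ 2) * (\<Sum>h\<leftarrow>hs. h ^ 2) = (\<Sum>k\<leftarrow>concat (map (\<lambda>g. map (\<lambda>h. g * h) hs) gs). k ^ 2)"
proof (induction gs)
  case (Cons g gs)
  have "g ^ 2 * (\<Sum>h\<leftarrow>hs. h ^ 2) = (\<Sum>k\<leftarrow>map (\<lambda>h. g * h) hs. k ^ 2)"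
    by (induction hs) (simp_all add: distrib_left power_mult_distrib)
  then show ?case using Cons by (simp add: distrib_right)
qed simp

lemma sos_mod_preordering:
  assumes "is_ideal I"
  shows "preordering (sos_mod I)"
  unfolding preordering_def
proof (intro conjI ballI allI)
  note I = is_idealD[OF assms]
  fix x y assume "x \<in> sos_mod I" "y \<in> sos_mod I"
  then obtain gs hs where gh: "x - (\<Sum>g\<leftarrow>gs. g ^ 2) \<in> I" "y - (\<Sum>g\<leftarrow>hs. g ^ 2) \<in> I"
    unfolding sos_mod_def by blast
  have "x + y - (\<Sum>g\<leftarrow>gs @ hs. g ^ 2) \<in> I" using I(2)[OF gh] by (simp add: algebra_simps)
  then show "x + y \<in> sos_mod I" unfolding sos_mod_def by blast
  define s t where "s = (\<Sum>g\<leftarrow>gs. g ^ 2)" and "t = (\<Sum>g\<leftarrow>hs. g ^ 2)"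
  have "y * (x - s) + s * (y - t) \<in> I" using I(2,3) gh unfolding s_def t_def by blast
  moreover have "y * (x - s) + s * (y - t) = x * y - s * t" by (simp add: algebra_simps)
  ultimately have "x * y - (\<Sum>k\<leftarrow>concat (map (\<lambda>g. map (\<lambda>h. g * h) hs) gs). k ^ 2) \<in> I"
    unfolding s_def t_def sum_list_squares_mult by simp
  then show "x * y \<in> sos_mod I" unfolding sos_mod_def by blast
next
  fix x
  have "x * x - (\<Sum>g\<leftarrow>[x]. g ^ 2) \<in> I" using is_idealD(1)[OF assms] by (simp add: power2_eq_square)
  then show "x * x \<in> sos_mod I" unfolding sos_mod_def by blast
qed

lemma ideal_subset_sos_mod: "I \<subseteq> sos_mod I"
proof
  fix x assume "x \<in> I"
  then have "x - (\<Sum>g\<leftarrow>[]. g ^ 2) \<in> I" by simp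
  then show "x \<in> sos_mod I" unfolding sos_mod_def by blast
qed

theorem Positivstellensatz:
  fixes I :: "'n::finite rpoly set"
  assumes I: "is_ideal I" and pos: "\<And>x. x \<in> real_variety I \<Longrightarrow> 0 < eval l x"
  shows "\<exists>s\<in>sos_mod I. \<exists>t\<in>sos_mod I. s * l = 1 + t"
proof -
  let ?T = "sos_mod I"
  let ?M = "{a + - l * b | a b. a \<in> ?T \<and> b \<in> ?T}"
  note T = sos_mod_preordering[OF I]
  have pre: "preordering ?M" by (rule preordering_adjoin[OF T])
  have "- 1 \<in> ?M"
  proof (rule ccontr)
    assume "- 1 \<notin> ?M"
    from preordering_subset_prime_cone[OF pre this] obtain P where P: "?M \<subseteq> P" "prime_cone P" by blast
    have MI: "a + - l * b \<in> P" if "a \<in> ?T" "b \<in> ?T" for a b using P(1) that by blast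
    have TP: "?T \<subseteq> P" using MI[OF _ preorderingD(4)[OF T]] by auto
    have lP: "- l \<in> P" using MI[OF preorderingD(4,5)[OF T]] by simp
    obtain G where G: "finite G" "G \<subseteq> I" "real_variety G = real_variety I"
      using real_variety_finite_subset[OF I] by blast
    obtain a where a: "realizes P (insert l G) a"
      using prime_cone_realized[OF P(2), of "insert l G"] G(1) by auto
    have "eval g a = 0" if "g \<in> G" for g
    proof -
      have "g \<in> P" "- g \<in> P" using that G(2) is_idealD(4)[OF I] ideal_subset_sos_mod TP by blast+
      then have "\<not> 0 < eval g a" "\<not> eval g a < 0" using a that unfolding realizes_def by blast+
      then show ?thesis by simp
    qed
    then have "a \<in> real_variety I" using G(3) unfolding real_variety_def by blast
    moreover have "\<not> 0 < eval l a" using a lP unfolding realizes_def by blast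
    ultimately show False using pos by blast
  qed
  then obtain a b where ab: "a \<in> ?T" "b \<in> ?T" "- 1 = a + - l * b" by blast
  then have "b * l = 1 + a" using minus_one_eq_addD[OF ab(3)] by (simp add: mult.commute)
  then show ?thesis using ab by blast
qed

section \<open>Archimedean preorderings\<close>

lemma rconst_mult: "rconst a * rconst b = rconst (a * b)"
  by (simp add: mult_single)

lemma rconst_add: "rconst a + rconst b = rconst (a + b)"
  by (simp flip: single_add)

lemma rconst_half: "rconst (1/2) * q + rconst (1/2) * q = q"
proof -
  have "rconst (1/2) * q + rconst (1/2) * q = rconst (1/2 + 1/2) * q"
    unfolding rconst_add[symmetric] by (rule distrib_right[symmetric])
  then show ?thesis by simp
qed

lemma rconst_mem:
  assumes "preordering T" "0 \<le> c"
  shows "rconst c \<in> T"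
  using preorderingD(3)[OF assms(1), of "rconst (sqrt c)"] assms(2) by (simp add: mult_single)

lemma preordering_sum: "preordering T \<Longrightarrow> (\<And>i. i \<in> S \<Longrightarrow> f i \<in> T) \<Longrightarrow> sum f S \<in> T"
  by (induction S rule: infinite_finite_induct) (auto intro: preorderingD)

definition norm_sq :: "'n::finite rpoly" where
  "norm_sq = (\<Sum>i\<in>UNIV. rvar i * rvar i)"

lemma archimedean_preordering:
  fixes T :: "'n::finite rpoly set"
  assumes T: "preordering T" and R: "rconst R - norm_sq \<in> T"
  shows "\<exists>M. rconst M - p \<in> T"
proof -
  note Td = preorderingD[OF T]
  have "\<exists>M. rconst M - p \<in> T \<and> rconst M + p \<in> T" if "p \<in> polys_in UNIV" for p :: "'n rpoly"
    using that
  proof (induction rule: polys_in.induct)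
    case (const r)
    have "rconst (\<bar>r\<bar> - r) \<in> T" "rconst (\<bar>r\<bar> + r) \<in> T" by (intro rconst_mem[OF T]; simp)+
    then show ?case by (intro exI[of _ "\<bar>r\<bar>"]) (simp add: single_diff single_add)
  next
    case (var i)
    let ?x = "rvar i :: 'n rpoly"
    have nsq: "norm_sq = ?x * ?x + (\<Sum>j\<in>UNIV - {i}. rvar j * rvar j)"
      unfolding norm_sq_def by (intro sum.remove) auto
    have "(\<Sum>j\<in>UNIV - {i}. rvar j * rvar j) \<in> T" by (intro preordering_sum[OF T] Td(3))
    from Td(1)[OF R this] have b: "rconst R - ?x * ?x \<in> T" unfolding nsq by simp
    have h: "rconst (1/2) * q + rconst (1/2) * q = q" "q * rconst (1/2) + q * rconst (1/2) = q"
      for q :: "'n rpoly"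
      using rconst_half[of q] by (simp_all only: mult.commute)
    have "rconst (R + 1/4) + ?x = (rconst R - ?x * ?x) + (?x + rconst (1/2)) * (?x + rconst (1/2))"
      using h[of ?x] by (simp add: distrib_left distrib_right rconst_mult algebra_simps flip: rconst_add)
    moreover have "rconst (R + 1/4) - ?x = (rconst R - ?x * ?x) + (?x - rconst (1/2)) * (?x - rconst (1/2))"
      using h[of ?x] by (simp add: left_diff_distrib right_diff_distrib rconst_mult algebra_simps flip: rconst_add)
    ultimately show ?case using Td(1)[OF b Td(3)] by metis
  next
    case (add p q)
    then obtain M N where "rconst M - p \<in> T" "rconst M + p \<in> T" "rconst N - q \<in> T" "rconst N + q \<in> T" by blast
    then have "(rconst M - p) + (rconst N - q) \<in> T" "(rconst M + p) + (rconst N + q) \<in> T" using Td(1) by blast+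
    then show ?case by (intro exI[of _ "M + N"]) (simp add: algebra_simps flip: rconst_add)
  next
    case (mult p q)
    then obtain M N where MN: "rconst M - p \<in> T" "rconst M + p \<in> T" "rconst N - q \<in> T" "rconst N + q \<in> T" by blast
    have half: "rconst (1/2) \<in> T" by (rule rconst_mem[OF T]) simp
    have "rconst (1/2) * ((rconst M + p) * (rconst N + q) + (rconst M - p) * (rconst N - q)) \<in> T"
      "rconst (1/2) * ((rconst M + p) * (rconst N - q) + (rconst M - p) * (rconst N + q)) \<in> T"
      using Td(1)[OF Td(2)[OF MN(2,4)] Td(2)[OF MN(1,3)]] Td(1)[OF Td(2)[OF MN(2,3)] Td(2)[OF MN(1,4)]]
        Td(2)[OF half] by blast+
    moreover have h: "rconst (1/2) * (q + q) = q" for q :: "'n rpoly"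
      by (simp only: distrib_left rconst_half)
    have "rconst (1/2) * ((rconst M + p) * (rconst N + q) + (rconst M - p) * (rconst N - q)) = rconst (M * N) + p * q"
      by (subst h[symmetric, of "rconst (M * N) + p * q"]) (simp add: algebra_simps rconst_mult)
    moreover have "rconst (1/2) * ((rconst M + p) * (rconst N - q) + (rconst M - p) * (rconst N + q)) = rconst (M * N) - p * q"
      by (subst h[symmetric, of "rconst (M * N) - p * q"]) (simp add: algebra_simps rconst_mult)
    ultimately show ?case by metis
  qed
  then show ?thesis using polys_in_UNIV by blast
qed

text \<open>Woermann's trick: \<open>M - t\<close> lies in \<open>T + g T\<close>, and multiplication by \<open>1 + t\<close> moves it into
  \<open>T\<close>, because \<open>(1 + t) g = s g\<^sup>2\<close>.\<close>
lemma norm_sq_bounded_mod: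
  fixes I :: "'n::finite rpoly set"
  assumes I: "is_ideal I" and st: "s \<in> sos_mod I" "t \<in> sos_mod I" "s * (rconst R - norm_sq) = 1 + t" and R: "0 \<le> R"
  shows "\<exists>C. rconst C - norm_sq \<in> sos_mod I"
proof -
  let ?T = "sos_mod I"
  note T = sos_mod_preordering[OF I]
  note Td = preorderingD[OF T]
  define g where "g = rconst R - (norm_sq :: 'n rpoly)"
  let ?M = "{a + g * b | a b. a \<in> ?T \<and> b \<in> ?T}"
  have "0 + g * 1 \<in> ?M" using Td(4,5) by blast
  then have "rconst R - norm_sq \<in> ?M" by (simp add: g_def)
  from archimedean_preordering[OF preordering_adjoin[OF T] this, of t]
  obtain M a b where ab: "a \<in> ?T" "b \<in> ?T" "rconst M - t = a + g * b" by blast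
  have t1: "1 + t \<in> ?T" using Td(1,5) st(2) by blast
  have "(1 + t) * g = s * (g * g)" using st(3) unfolding g_def[symmetric] by (metis mult.assoc)
  then have gT: "(1 + t) * g \<in> ?T" using Td(2)[OF st(1) Td(3)] by simp
  have "(1 + t) * (rconst M - t) = (1 + t) * a + ((1 + t) * g) * b" unfolding ab(3) by (simp add: distrib_left mult.assoc)
  then have "(1 + t) * (rconst M - t) \<in> ?T" using Td(1)[OF Td(2)[OF t1 ab(1)] Td(2)[OF gT ab(2)]] by simp
  from Td(1)[OF this Td(3)[of "rconst (M / 2) - t"]]
  have "(1 + t) * (rconst M - t) + (rconst (M / 2) - t) * (rconst (M / 2) - t) \<in> ?T" .
  moreover have "(1 + t) * (rconst M - t) + (rconst (M / 2) - t) * (rconst (M / 2) - t) = rconst (M + M^2 / 4) - t"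
  proof -
    have "rconst M * t = rconst (M / 2) * t + rconst (M / 2) * t" by (simp add: rconst_add flip: distrib_right)
    moreover have "rconst (M / 2) * rconst (M / 2) = rconst (M^2 / 4)" by (simp add: rconst_mult power2_eq_square)
    ultimately show ?thesis by (simp add: algebra_simps flip: rconst_add)
  qed
  ultimately have C: "rconst (M + M^2 / 4) - t \<in> ?T" by simp
  define C where "C = M + M^2 / 4"
  have "norm_sq \<in> ?T" unfolding norm_sq_def by (intro preordering_sum[OF T] Td(3))
  then have "(1 + t) * g + t * norm_sq + rconst R * (rconst C - t) \<in> ?T"
    using Td(1)[OF Td(1)[OF gT Td(2)[OF st(2)]] Td(2)[OF rconst_mem[OF T R] C]] unfolding C_def by blast
  moreover have "(1 + t) * g + t * norm_sq + rconst R * (rconst C - t) = rconst (R + R * C) - norm_sq"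
    by (simp add: g_def algebra_simps flip: rconst_add rconst_mult)
  ultimately show ?thesis by metis
qed

text \<open>If \<open>l + r\<close> is in the preordering, then so is \<open>l + r - 1/N\<close>, because
  \<open>N (l + r) - 1 = (N - s) (l + r) + (s l - 1) + r s\<close>.\<close>
lemma positive_mem_archimedean:
  fixes T :: "'n::finite rpoly set"
  assumes T: "preordering T" and arch: "\<And>p. \<exists>M. rconst M - p \<in> T"
    and st: "s \<in> T" "t \<in> T" "s * l = 1 + t"
  shows "l \<in> T"
proof -
  note Td = preorderingD[OF T]
  obtain M where M: "rconst M - s \<in> T" using arch by blast
  define N where "N = \<bar>M\<bar> + 1"
  have N: "N > 0" by (simp add: N_def)
  have "rconst (N - M) \<in> T" by (rule rconst_mem[OF T]) (simp add: N_def)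
  from Td(1)[OF this M] have NT: "rconst N - s \<in> T" by (simp add: single_diff)
  obtain K where "rconst K - (- l) \<in> T" using arch by blast
  then have K: "l + rconst K \<in> T" by (simp add: add.commute)
  have step: "l + rconst (r - 1 / N) \<in> T" if r: "0 \<le> r" "l + rconst r \<in> T" for r
  proof -
    have "(rconst N - s) * (l + rconst r) + t + rconst r * s \<in> T"
      using Td(1)[OF Td(1)[OF Td(2)[OF NT r(2)] st(2)] Td(2)[OF rconst_mem[OF T r(1)] st(1)]] .
    moreover have "t = s * l - 1" using st(3) by simp
    then have "(rconst N - s) * (l + rconst r) + t + rconst r * s = rconst N * (l + rconst r) - 1"
      by (simp add: algebra_simps)
    ultimately have "rconst (1 / N) * (rconst N * (l + rconst r) - 1) \<in> T"
      using Td(2)[OF rconst_mem[OF T]] N by simp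
    moreover have "rconst (1 / N) * (rconst N * (l + rconst r) - 1) = l + rconst (r - 1 / N)"
      using N by (simp add: right_diff_distrib rconst_mult single_diff flip: mult.assoc)
    ultimately show ?thesis by simp
  qed
  have descend: "l + rconst (real k / N) \<in> T \<Longrightarrow> l \<in> T" for k
  proof (induction k)
    case (Suc k)
    have "l + rconst (real (Suc k) / N - 1 / N) \<in> T" using Suc.prems N by (intro step) auto
    moreover have "real (Suc k) / N - 1 / N = real k / N" by (simp add: add_divide_distrib)
    ultimately show ?case using Suc.IH by simp
  qed simp
  obtain k :: nat where "K * N \<le> real k" using real_arch_simple by blast
  then have "0 \<le> real k / N - K" using N by (simp add: field_simps)
  from Td(1)[OF K rconst_mem[OF T this]] have "l + rconst (real k / N) \<in> T"
    by (simp add: add.assoc rconst_add)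
  then show ?thesis by (rule descend)
qed

lemma eval_norm_sq: "eval norm_sq x = (norm x)\<^sup>2"
proof -
  have "eval norm_sq x = (\<Sum>i\<in>UNIV. eval (rvar i * rvar i) x)"
    unfolding norm_sq_def by (rule typed_ring_hom.hom_sum[OF eval_hom])
  also have "\<dots> = (\<Sum>i\<in>UNIV. x $ i * x $ i)" by (simp add: eval_mult)
  also have "\<dots> = x \<bullet> x" by (simp add: inner_vec_def)
  finally show ?thesis by (simp add: dot_square_norm)
qed

theorem Schmuedgen:
  fixes I :: "'n::finite rpoly set"
  assumes I: "is_ideal I" and comp: "compact (real_variety I)"
    and pos: "\<And>x. x \<in> real_variety I \<Longrightarrow> 0 < eval l x"
  shows "l \<in> sos_mod I"
proof -
  note T = sos_mod_preordering[OF I]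
  obtain B where B: "\<And>x. x \<in> real_variety I \<Longrightarrow> norm x \<le> B"
    using compact_imp_bounded[OF comp] unfolding bounded_iff by blast
  have "0 < eval (rconst (B\<^sup>2 + 1) - norm_sq) x" if "x \<in> real_variety I" for x
  proof -
    have "(norm x)\<^sup>2 \<le> B\<^sup>2" using B[OF that] by (intro power_mono) auto
    then show ?thesis by (simp add: typed_ring_hom.hom_diff[OF eval_hom] eval_norm_sq)
  qed
  from Positivstellensatz[OF I this] obtain s t
    where "s \<in> sos_mod I" "t \<in> sos_mod I" "s * (rconst (B\<^sup>2 + 1) - norm_sq) = 1 + t" by blast
  from norm_sq_bounded_mod[OF I this] obtain C where C: "rconst C - norm_sq \<in> sos_mod I" by auto
  obtain s t where st: "s \<in> sos_mod I" "t \<in> sos_mod I" "s * l = 1 + t"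
    using Positivstellensatz[OF I pos] by blast
  show ?thesis by (rule positive_mem_archimedean[OF T archimedean_preordering[OF T C] st])
qed

section \<open>Theta bodies\<close>

lemma monomial_degree_le_1:
  fixes m :: "'n::finite \<Rightarrow>\<^sub>0 nat"
  assumes "mon_deg m \<le> 1"
  shows "m = 0 \<or> (\<exists>i. m = Poly_Mapping.single i 1)"
proof (cases "m = 0")
  case False
  then obtain i where i: "Poly_Mapping.lookup m i \<noteq> 0" by (metis lookup_zero poly_mapping_eqI)
  have "mon_deg m = Poly_Mapping.lookup m i + (\<Sum>j\<in>UNIV - {i}. Poly_Mapping.lookup m j)"
    unfolding mon_deg_def by (intro sum.remove) auto
  then have li: "Poly_Mapping.lookup m i = 1" and "(\<Sum>j\<in>UNIV - {i}. Poly_Mapping.lookup m j) = 0"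
    using assms i by linarith+
  then have "Poly_Mapping.lookup m j = 0" if "j \<noteq> i" for j using that by auto
  then have "m = Poly_Mapping.single i 1"
    by (intro poly_mapping_eqI) (metis li lookup_single_eq lookup_single_not_eq)
  then show ?thesis by blast
qed simp

lemma eval_affine:
  fixes x y :: "real ^ 'n::finite"
  assumes "total_deg l \<le> 1" "u + v = 1"
  shows "eval l (u *\<^sub>R x + v *\<^sub>R y) = u * eval l x + v * eval l y"
proof -
  define e where "e m x = (\<Prod>i\<in>UNIV. (x $ i) ^ Poly_Mapping.lookup m i)" for m and x :: "real ^ 'n"
  have "e m (u *\<^sub>R x + v *\<^sub>R y) = u * e m x + v * e m y" if "m \<in> Poly_Mapping.keys l" for m
  proof -
    have "mon_deg m \<le> total_deg l" using that unfolding total_deg_def by auto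
    then have "m = 0 \<or> (\<exists>i. m = Poly_Mapping.single i 1)" using assms(1) by (intro monomial_degree_le_1) simp
    moreover have "e 0 x = 1" for x by (simp add: e_def)
    moreover have "e (Poly_Mapping.single i 1) x = x $ i" for i x
      using eval_rvar[of i x] by (simp add: rvar_def eval_single e_def)
    ultimately show ?thesis using assms(2) by auto
  qed
  then have "(\<Sum>m\<in>Poly_Mapping.keys l. Poly_Mapping.lookup l m * e m (u *\<^sub>R x + v *\<^sub>R y)) =
      (\<Sum>m\<in>Poly_Mapping.keys l. u * (Poly_Mapping.lookup l m * e m x) + v * (Poly_Mapping.lookup l m * e m y))"
    by (intro sum.cong) (auto simp: algebra_simps)
  then show ?thesis unfolding Defs.eval_def e_def[symmetric] by (simp add: sum.distrib sum_distrib_left)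
qed

lemma continuous_on_eval: "continuous_on S (eval l)"
  unfolding Defs.eval_def[abs_def] by (intro continuous_intros)

lemma theta_body_convex: "convex (theta_body k I)"
  unfolding convex_def theta_body_def by (auto simp: eval_affine)

lemma theta_body_closed: "closed (theta_body k I)"
proof -
  have "theta_body k I = (\<Inter>l\<in>{l. total_deg l \<le> 1 \<and> k_sos_mod k I l}. {x. 0 \<le> eval l x})"
    unfolding theta_body_def by auto
  moreover have "closed {x. 0 \<le> eval l x}" for l :: "'a rpoly"
    by (intro closed_Collect_le continuous_on_const continuous_on_eval)
  ultimately show ?thesis by auto
qed

lemma real_variety_subset_theta_body: "real_variety I \<subseteq> theta_body k I"
proof
  fix x assume x: "x \<in> real_variety I"
  interpret e: typed_ring_hom "\<lambda>q. eval q x" by (rule eval_hom)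
  have "0 \<le> eval l x" if l: "k_sos_mod k I l" for l
  proof -
    obtain gs where "l - (\<Sum>g\<leftarrow>gs. g ^ 2) \<in> I" using l unfolding k_sos_mod_def by blast
    then have "eval (l - (\<Sum>g\<leftarrow>gs. g ^ 2)) x = 0" using x unfolding real_variety_def by blast
    moreover have "0 \<le> eval (\<Sum>g\<leftarrow>gs. g ^ 2) x"
      by (induction gs) (simp_all add: e.hom_add e.hom_power)
    ultimately show ?thesis by (simp add: e.hom_diff)
  qed
  then show "x \<in> theta_body k I" unfolding theta_body_def by blast
qed

lemma sos_mod_imp_k_sos_mod:
  assumes "h \<in> sos_mod I"
  shows "\<exists>k. k_sos_mod k I h"
proof -
  obtain gs where gs: "h - (\<Sum>g\<leftarrow>gs. g ^ 2) \<in> I" using assms unfolding sos_mod_def by blast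
  have "\<forall>g\<in>set gs. total_deg g \<le> Max (total_deg ` set gs)" by auto
  then show ?thesis using gs unfolding k_sos_mod_def by blast
qed

lemma linear_polynomial:
  fixes a :: "real ^ 'n::finite"
  shows "\<exists>l. total_deg l \<le> 1 \<and> (\<forall>x. eval l x = a \<bullet> x - b)"
proof -
  define l where "l = (\<Sum>i\<in>UNIV. Poly_Mapping.single (Poly_Mapping.single i 1) (a $ i)) - rconst b"
  have keys: "Poly_Mapping.keys l \<subseteq> insert 0 (range (\<lambda>i. Poly_Mapping.single i 1))"
  proof
    fix m assume "m \<in> Poly_Mapping.keys l"
    then have "(\<Sum>i\<in>UNIV. Poly_Mapping.lookup (Poly_Mapping.single (Poly_Mapping.single i 1) (a $ i)) m) - Poly_Mapping.lookup (rconst b) m \<noteq> 0"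
      unfolding l_def in_keys_iff lookup_minus lookup_sum by blast
    then show "m \<in> insert 0 (range (\<lambda>i. Poly_Mapping.single i 1))"
      by (metis (no_types, lifting) diff_zero insert_iff lookup_single_not_eq rangeI sum.neutral)
  qed
  have "mon_deg (Poly_Mapping.single i 1) = 1" for i :: 'n
    by (simp add: mon_deg_def lookup_single when_def)
  then have "mon_deg m \<le> 1" if "m \<in> Poly_Mapping.keys l" for m
    using keys that by (auto simp: mon_deg_def)
  then have "total_deg l \<le> 1" unfolding total_deg_def by auto
  moreover have "eval l x = a \<bullet> x - b" for x
  proof -
    interpret e: typed_ring_hom "\<lambda>q. eval q x" by (rule eval_hom)
    have "Poly_Mapping.single (Poly_Mapping.single i 1) (a $ i) = rconst (a $ i) * rvar i" for i
      by (simp add: rvar_def mult_single)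
    then show ?thesis by (simp add: l_def e.hom_diff e.hom_sum e.hom_mult inner_vec_def)
  qed
  ultimately show ?thesis by blast
qed

theorem mainTheorem10:
  fixes I :: "'n::finite rpoly set"
  assumes "is_ideal I"
    and "compact (real_variety I)"
  shows "(\<Inter>k. theta_body k I) = closure (convex hull (real_variety I))"
proof
  show "closure (convex hull (real_variety I)) \<subseteq> (\<Inter>k. theta_body k I)"
    by (intro INT_greatest closure_minimal hull_minimal real_variety_subset_theta_body
        theta_body_convex theta_body_closed)
  show "(\<Inter>k. theta_body k I) \<subseteq> closure (convex hull (real_variety I))"
  proof (rule ccontr)
    assume "\<not> ?thesis"
    then obtain p where p: "\<And>k. p \<in> theta_body k I" "p \<notin> closure (convex hull (real_variety I))" by blast
    obtain a b where ab: "a \<bullet> p < b" "\<forall>x\<in>closure (convex hull (real_variety I)). b < a \<bullet> x"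
      using separating_hyperplane_closed_point[OF convex_closure[OF convex_convex_hull] closed_closure p(2)] by blast
    obtain l where l: "total_deg l \<le> 1" "\<And>x. eval l x = a \<bullet> x - b" using linear_polynomial by blast
    have "0 < eval l x" if "x \<in> real_variety I" for x
      using ab(2) that hull_subset[of "real_variety I" convex] closure_subset[of "convex hull (real_variety I)"]
      by (auto simp: l(2))
    from Schmuedgen[OF assms this] obtain k where "k_sos_mod k I l" using sos_mod_imp_k_sos_mod by blast
    then have "0 \<le> eval l p" using p(1)[of k] l(1) unfolding theta_body_def by blast
    then show False using ab(1) l(2) by simp
  qed
qed

end
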